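(* Let $n\ge 1$ be an integer, let $D_g\subset\mathbb{R}^{n_x}$ and $D_f\subset\mathbb{R}^{n_y}$ be open sets, let $g:D_g\to\mathbb{R}^{n_y}$ be $n$ times differentiable with $g(D_g)\subset D_f$, and let $f:D_f\to\mathbb{R}^{n_f}$ be $n$ times differentiable. Then for every $x\in D_g$ and every increment $dx\in\mathbb{R}^{n_x}$ the $n$-th order total derivative (differential) of $f\circ g$ is $$d^{n} f(g(x)) = \sum_{k=1}^{n} f_{g^{k}}(g(x))\, \mathbf{B}^g_{n,k}\,(dx)^{\otimes n},$$ where $f_{g^k}(g(x))$ is the $n_f\times n_y^k$ matrix of $k$-th order partial derivatives of $f$ evaluated at $g(x)$, $g_{x^l}(x)$ is the $n_y\times n_x^l$ matrix of $l$-th order partial derivatives of $g$ at $x$, and $\mathbf{B}^g_{n,k}$ is the multivariate partial Bell polynomial in $g_x(x),\dots,g_{x^{n-k+1}}(x)$.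
   Context: $\otimes$ is the Kronecker product and $A^{\otimes m}$ the $m$-fold Kronecker power ($A^{\otimes 0}=1$). Vectors $x\in\mathbb{R}^{n_x}$, $f$, $g$, $dx$ are column vectors. Matrix derivatives: put $\frac{\partial}{\partial x'}=\left(\frac{\partial}{\partial x_1},\dots,\frac{\partial}{\partial x_{n_x}}\right)$ (a row). For a matrix function $F$ of $x$, $F_x=\frac{\partial F}{\partial x'}:=F\otimes\frac{\partial}{\partial x'}$, i.e. each entry $F_{i,j}$ is replaced by the row $\left(\frac{\partial F_{i,j}}{\partial x_1},\dots,\frac{\partial F_{i,j}}{\partial x_{n_x}}\right)$; iterating, $F_{x^k}:=F\otimes\left(\frac{\partial}{\partial x'}\right)^{\otimes k}$. Thus $g_{x^l}$ is $n_y\times n_x^l$, and $f_{g^k}$ denotes the analogous $n_f\times n_y^k$ matrix of derivatives of $f$ with respect to its argument $y=g(x)\in\mathbb{R}^{n_y}$. Differentials: for a vector function $h$ of $x$, the $n$-th order differential at $x$ with (constant) increment $dx$ is $d^n h=h_{x^n}(dx)^{\otimes n}$; here $d^n f(g(x))$ is the $n$-th differential of $h=f\circ g$. Multivariate partial Bell polynomial: for $1\le k\le n$, $\mathbf{B}^g_{n,k}$ is the $n_y^k\times n_x^n$ matrix $$\mathbf{B}^g_{n,k}=\sum \frac{n!}{j_1!j_2!\cdots j_{n-k+1}!}\left(\frac{g_x(x)}{1!}\right)^{\otimes j_1}\otimes\left(\frac{g_{x^2}(x)}{2!}\right)^{\otimes j_2}\otimes\cdots\otimes\left(\frac{g_{x^{n-k+1}}(x)}{(n-k+1)!}\right)^{\otimes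 j_{n-k+1}},$$ the sum being over all sequences $j_1,\dots,j_{n-k+1}$ of non-negative integers with $\sum_l j_l=k$ and $\sum_l l\,j_l=n$. *)

theory Defs
  imports "HOL-Analysis.Analysis" "Jordan_Normal_Form.Matrix"
begin

text \<open>
  Points live in \<^typ>\<open>real ^ 'n\<close>, where differentiability makes sense; the derivative matrices,
  whose sizes \<open>n\<^sub>y \<times> n\<^sub>x ^ k\<close> depend on \<open>k\<close>, are the dynamically sized \<^typ>\<open>real mat\<close>, with
  0-based indices. The linear order on the index type only fixes which coordinate comes first.
\<close>

definition nth_index :: "nat \<Rightarrow> 'n::{finite,linorder}" where
  "nth_index i = sorted_list_of_set (UNIV :: 'n set) ! i"

definition col_mat :: "real ^ 'n::{finite,linorder} \<Rightarrow> real mat" where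
  "col_mat v = Matrix.mat CARD('n) 1 (\<lambda>(i, j). vec_nth v (nth_index i))"

definition kron :: "real mat \<Rightarrow> real mat \<Rightarrow> real mat" where
  "kron A B = Matrix.mat (dim_row A * dim_row B) (dim_col A * dim_col B)
     (\<lambda>(i, j). A $$ (i div dim_row B, j div dim_col B) * B $$ (i mod dim_row B, j mod dim_col B))"

primrec kron_pow :: "real mat \<Rightarrow> nat \<Rightarrow> real mat" where
  "kron_pow A 0 = 1\<^sub>m 1"
| "kron_pow A (Suc m) = kron A (kron_pow A m)"

definition kron_list :: "real mat list \<Rightarrow> real mat" where
  "kron_list As = foldr kron As (1\<^sub>m 1)"

text \<open>
  Since \<^typ>\<open>real mat\<close> has no global zero, the size \<open>r \<times> c\<close> of the sum is passed explicitly; the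
  summands are meant to have this size (cf. the lemmas at the end).
\<close>

definition mat_sum :: "nat \<Rightarrow> nat \<Rightarrow> ('i \<Rightarrow> real mat) \<Rightarrow> 'i set \<Rightarrow> real mat" where
  "mat_sum r c F S = Matrix.mat r c (\<lambda>ij. \<Sum>s\<in>S. F s $$ ij)"

definition partial_deriv :: "'n::{finite,linorder} \<Rightarrow> (real ^ 'n::{finite,linorder} \<Rightarrow> real) \<Rightarrow> real ^ 'n::{finite,linorder} \<Rightarrow> real" where
  "partial_deriv i h x = deriv (\<lambda>t. h (x + t *\<^sub>R axis i 1)) 0"

text \<open>
  \<open>F\<^sub>x = F \<otimes> \<partial>/\<partial>x'\<close>: every entry is replaced by its row of partial derivatives, so column
  \<open>j * n\<^sub>x + l\<close> of the result holds the derivatives of column \<open>j\<close> in direction \<open>l\<close>.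
\<close>

definition mat_deriv :: "(real ^ 'n::{finite,linorder} \<Rightarrow> real mat) \<Rightarrow> real ^ 'n::{finite,linorder} \<Rightarrow> real mat" where
  "mat_deriv F x = Matrix.mat (dim_row (F x)) (dim_col (F x) * CARD('n))
     (\<lambda>(i, j). partial_deriv (nth_index (j mod CARD('n))) (\<lambda>y. F y $$ (i, j div CARD('n))) x)"

definition deriv_mat ::
  "nat \<Rightarrow> (real ^ 'n::{finite,linorder} \<Rightarrow> real ^ 'm::{finite,linorder}) \<Rightarrow> real ^ 'n::{finite,linorder} \<Rightarrow> real mat" where
  "deriv_mat k h = (mat_deriv ^^ k) (\<lambda>x. col_mat (h x))"

definition differential ::
  "nat \<Rightarrow> (real ^ 'n::{finite,linorder} \<Rightarrow> real ^ 'm::{finite,linorder}) \<Rightarrow>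
    real ^ 'n::{finite,linorder} \<Rightarrow> real ^ 'n::{finite,linorder} \<Rightarrow> real mat" where
  "differential n h x dx = deriv_mat n h x * kron_pow (col_mat dx) n"

text \<open>
  Iterated (Frechet) differentiability on an open set: \<open>h\<close> is differentiable and its derivative
  \<open>x \<mapsto> Dh(x)\<close> is \<open>n\<close> times differentiable. In finite dimension the latter can be tested on all
  \<open>x \<mapsto> Dh(x) v\<close>, which keeps the type fixed in the recursion.
\<close>

primrec times_differentiable_on ::
  "nat \<Rightarrow> ('a::euclidean_space \<Rightarrow> 'b::real_normed_vector) \<Rightarrow> 'a set \<Rightarrow> bool" where
  "times_differentiable_on 0 h S = True"
| "times_differentiable_on (Suc n) h S =
     ((\<forall>x\<in>S. h differentiable at x) \<and>
      (\<forall>v. times_differentiable_on n (\<lambda>x. frechet_derivative h (at x) v) S))"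

text \<open>
  The sequences \<open>j\<^sub>1, \<dots>, j\<^bsub>n-k+1\<^esub>\<close>. Members are extensional functions, so that each sequence is
  counted once.
\<close>

definition bell_indices :: "nat \<Rightarrow> nat \<Rightarrow> (nat \<Rightarrow> nat) set" where
  "bell_indices n k = {j \<in> {1..n-k+1} \<rightarrow>\<^sub>E UNIV.
     (\<Sum>l=1..n-k+1. j l) = k \<and> (\<Sum>l=1..n-k+1. l * j l) = n}"

definition bell_mat ::
  "nat \<Rightarrow> nat \<Rightarrow> (real ^ 'n::{finite,linorder} \<Rightarrow> real ^ 'm::{finite,linorder}) \<Rightarrow>
    real ^ 'n::{finite,linorder} \<Rightarrow> real mat" where
  "bell_mat n k g x = mat_sum (CARD('m) ^ k) (CARD('n) ^ n)
     (\<lambda>j. (fact n / (\<Prod>l=1..n-k+1. fact (j l))) \<cdot>\<^sub>m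
        kron_list (map (\<lambda>l. kron_pow ((1 / fact l) \<cdot>\<^sub>m deriv_mat l g x) (j l)) [1..<n-k+2]))
     (bell_indices n k)"

lemma bij_betw_nth_index: "bij_betw nth_index {..<CARD('n)} (UNIV :: 'n::{finite,linorder} set)"
  using bij_betw_nth[of "sorted_list_of_set (UNIV :: 'n set)" "{..<CARD('n)}" UNIV]
  by (simp add: nth_index_def[abs_def])

lemma kron_carrier:
  "A \<in> carrier_mat a b \<Longrightarrow> B \<in> carrier_mat c d \<Longrightarrow> kron A B \<in> carrier_mat (a * c) (b * d)"
  by (auto simp: kron_def)

lemma kron_pow_carrier: "A \<in> carrier_mat a b \<Longrightarrow> kron_pow A m \<in> carrier_mat (a ^ m) (b ^ m)"
  by (induction m) (auto intro!: kron_carrier)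

lemma col_mat_carrier: "col_mat (v :: real ^ 'n::{finite,linorder}) \<in> carrier_mat CARD('n) 1"
  by (simp add: col_mat_def)

lemma deriv_mat_carrier:
  "deriv_mat k (h :: real ^ 'n::{finite,linorder} \<Rightarrow> real ^ 'm::{finite,linorder}) x
     \<in> carrier_mat CARD('m) (CARD('n) ^ k)"
proof (induction k arbitrary: x)
  case 0
  show ?case by (simp add: deriv_mat_def col_mat_def)
next
  case (Suc k)
  have "deriv_mat (Suc k) h x = mat_deriv (deriv_mat k h) x"
    by (simp add: deriv_mat_def)
  with Suc[of x] show ?case by (auto simp: mat_deriv_def)
qed

lemma finite_bell_indices: "finite (bell_indices n k)"
proof (rule finite_subset)
  show "bell_indices n k \<subseteq> {1..n-k+1} \<rightarrow>\<^sub>E {..k}"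
  proof
    fix j assume "j \<in> bell_indices n k"
    hence j: "j \<in> {1..n-k+1} \<rightarrow>\<^sub>E UNIV" and s: "(\<Sum>l=1..n-k+1. j l) = k"
      by (auto simp: bell_indices_def)
    have "j l \<le> k" if "l \<in> {1..n-k+1}" for l
      using member_le_sum[of l "{1..n-k+1}" j] that s by auto
    thus "j \<in> {1..n-k+1} \<rightarrow>\<^sub>E {..k}" using j by (auto simp: PiE_iff)
  qed
  show "finite ({1..n-k+1} \<rightarrow>\<^sub>E {..k})" by (intro finite_PiE) auto
qed

lemma kron_list_carrier:
  assumes "\<And>l. l \<in> set ls \<Longrightarrow> A l \<in> carrier_mat (r l) (c l)"
  shows "kron_list (map A ls) \<in> carrier_mat (prod_list (map r ls)) (prod_list (map c ls))"
  using assms by (induction ls) (auto simp: kron_list_def intro!: kron_carrier)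

lemma bell_summand_carrier:
  fixes g :: "real ^ 'n::{finite,linorder} \<Rightarrow> real ^ 'm::{finite,linorder}"
  assumes "j \<in> bell_indices n k"
  shows "kron_list (map (\<lambda>l. kron_pow ((1 / fact l) \<cdot>\<^sub>m deriv_mat l g x) (j l)) [1..<n-k+2])
     \<in> carrier_mat (CARD('m) ^ k) (CARD('n) ^ n)"
proof -
  have set: "set [1..<n-k+2] = {1..n-k+1}" by auto
  have "kron_list (map (\<lambda>l. kron_pow ((1 / fact l) \<cdot>\<^sub>m deriv_mat l g x) (j l)) [1..<n-k+2])
     \<in> carrier_mat (prod_list (map (\<lambda>l. CARD('m) ^ j l) [1..<n-k+2]))
         (prod_list (map (\<lambda>l. (CARD('n) ^ l) ^ j l) [1..<n-k+2]))"
    by (intro kron_list_carrier kron_pow_carrier smult_carrier_mat deriv_mat_carrier)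
  moreover have "prod_list (map (\<lambda>l. CARD('m) ^ j l) [1..<n-k+2]) = CARD('m) ^ k"
    unfolding prod.distinct_set_conv_list[OF distinct_upt, symmetric] set power_sum[symmetric]
    using assms by (simp only: bell_indices_def mem_Collect_eq)
  moreover have "prod_list (map (\<lambda>l. (CARD('n) ^ l) ^ j l) [1..<n-k+2]) = CARD('n) ^ n"
    unfolding prod.distinct_set_conv_list[OF distinct_upt, symmetric] set
      power_mult[symmetric] power_sum[symmetric]
    using assms by (simp only: bell_indices_def mem_Collect_eq)
  ultimately show ?thesis by simp
qed

end

theory Submission
  imports Defs
begin

text \<open>
  Fix a direction \<open>dx\<close> and contract all derivative matrices with Kronecker products of columns:
  \<open>h\<^bsub>x^k\<^esub>\<close> applied to \<open>v\<^sub>1 \<otimes> \<dots> \<otimes> v\<^sub>k\<close> is the iterated directional derivative of \<open>h\<close> along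
  \<open>v\<^sub>1, \<dots>, v\<^sub>k\<close>. By the chain and product rules, differentiating a directional derivative of \<open>f\<close>
  at \<open>g x\<close> along \<open>d\<^bsup>l\<^esup>g\<close> (\<open>l\<close> running through a multiset \<open>M\<close>) either adjoins a new \<open>1\<close> to \<open>M\<close> or
  replaces some \<open>l\<close> by \<open>l + 1\<close>; by the symmetry of higher derivatives only the multiset matters.
  Induction on \<open>n\<close> then gives a sum over the multisets \<open>M\<close> of positive integers with sum \<open>n\<close>, and
  these correspond to the index sequences \<open>j\<close> of the Bell polynomials.
\<close>

subsection \<open>Directional derivatives\<close>

text \<open>The direction comes first so that \<open>dir_deriv v\<close> is an operator on
  functions, to be iterated by \<open>fold\<close> or \<open>^^\<close>.\<close>

definition dir_deriv ::
  "'a \<Rightarrow> ('a::real_normed_vector \<Rightarrow> 'b::real_normed_vector) \<Rightarrow> 'a \<Rightarrow> 'b" where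
  "dir_deriv v h x = frechet_derivative h (at x) v"

lemma dir_deriv_eqI: "(h has_derivative h') (at x) \<Longrightarrow> dir_deriv v h x = h' v"
  by (simp add: dir_deriv_def frechet_derivative_at[symmetric])

lemma has_derivative_dir_deriv:
  "h differentiable at x \<Longrightarrow> (h has_derivative (\<lambda>v. dir_deriv v h x)) (at x)"
  by (simp add: dir_deriv_def frechet_derivative_works)

text \<open>Being a derivative at \<open>x\<close> depends only on the values near \<open>x\<close>,
  and \<open>frechet_derivative\<close> is a choice among all derivatives there; hence the equality
  holds even at points where no derivative exists.\<close>

lemma dir_deriv_cong:
  assumes "open S" "x \<in> S" "\<And>y. y \<in> S \<Longrightarrow> h y = h' y"
  shows "dir_deriv v h x = dir_deriv v h' x"
proof -
  have "(h has_derivative D) (at x) \<longleftrightarrow> (h' has_derivative D) (at x)" for D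
    using has_derivative_transform_within_open[of h D x UNIV S h']
      has_derivative_transform_within_open[of h' D x UNIV S h] assms by auto
  thus ?thesis by (simp add: dir_deriv_def frechet_derivative_def)
qed

lemma dir_deriv_scaleR_sum:
  assumes "\<And>i. i \<in> I \<Longrightarrow> h i differentiable at x"
  shows "dir_deriv v (\<lambda>y. \<Sum>i\<in>I. c i *\<^sub>R h i y) x = (\<Sum>i\<in>I. c i *\<^sub>R dir_deriv v (h i) x)"
  by (rule dir_deriv_eqI) (auto intro!: derivative_eq_intros has_derivative_dir_deriv assms)

text \<open>Trades a direction, which in later uses varies with the point, for fixed basis
  directions with scalar coefficients, so that the product rule applies.\<close>

lemma dir_deriv_basis_expansion:
  fixes h :: "'a::euclidean_space \<Rightarrow> 'b::real_normed_vector"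
  assumes "h differentiable at x"
  shows "dir_deriv v h x = (\<Sum>b\<in>Basis. (v \<bullet> b) *\<^sub>R dir_deriv b h x)"
proof -
  interpret linear "\<lambda>v. dir_deriv v h x"
    using has_derivative_dir_deriv[OF assms] by (rule has_derivative_linear)
  show ?thesis
    by (subst (1) euclidean_representation[of v, symmetric]) (simp add: sum scaleR)
qed

section \<open>Calculus of \<open>n\<close> times differentiable maps\<close>

lemma times_differentiable_on_Suc:
  "times_differentiable_on (Suc n) h S \<longleftrightarrow>
     (\<forall>x\<in>S. h differentiable at x) \<and> (\<forall>v. times_differentiable_on n (dir_deriv v h) S)"
  by (simp add: dir_deriv_def[abs_def])

declare times_differentiable_on.simps(2) [simp del]

text \<open>Derivatives of concrete maps are computed only at points of \<open>S\<close>; this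
  transfers differentiability from the computed formula to \<open>dir_deriv v h\<close>
  itself.\<close>

lemma times_differentiable_on_cong:
  assumes "open S" "\<And>x. x \<in> S \<Longrightarrow> h x = h' x" "times_differentiable_on n h S"
  shows "times_differentiable_on n h' S"
  using assms(2,3)
proof (induction n arbitrary: h h')
  case (Suc n)
  have "h' differentiable at x" if "x \<in> S" for x
    using Suc.prems that assms(1) unfolding times_differentiable_on_Suc differentiable_def
    by (metis has_derivative_transform_within_open)
  moreover have "times_differentiable_on n (dir_deriv v h') S" for v
    by (rule Suc.IH[of "dir_deriv v h"])
      (use Suc.prems assms(1) in \<open>auto simp: times_differentiable_on_Suc intro: dir_deriv_cong\<close>)
  ultimately show ?case by (simp add: times_differentiable_on_Suc)
qed simp

lemma times_differentiable_on_mono: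
  "times_differentiable_on n h S \<Longrightarrow> m \<le> n \<Longrightarrow> times_differentiable_on m h S"
proof (induction n arbitrary: m h)
  case (Suc n)
  thus ?case by (cases m) (auto simp: times_differentiable_on_Suc)
qed simp

lemma times_differentiable_on_imp_differentiable:
  "times_differentiable_on n h S \<Longrightarrow> 0 < n \<Longrightarrow> x \<in> S \<Longrightarrow> h differentiable at x"
  by (cases n) (auto simp: times_differentiable_on_Suc)

lemma times_differentiable_on_add:
  assumes "open S" "times_differentiable_on n h S" "times_differentiable_on n k S"
  shows "times_differentiable_on n (\<lambda>x. h x + k x) S"
  using assms(2,3)
proof (induction n arbitrary: h k)
  case (Suc n)
  have "dir_deriv v h x + dir_deriv v k x = dir_deriv v (\<lambda>x. h x + k x) x" if "x \<in> S" for v x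
    by (rule dir_deriv_eqI[symmetric])
      (use Suc.prems that in
        \<open>auto simp: times_differentiable_on_Suc intro!: derivative_eq_intros has_derivative_dir_deriv\<close>)
  hence "times_differentiable_on n (dir_deriv v (\<lambda>x. h x + k x)) S" for v
    by (rule times_differentiable_on_cong[OF assms(1),
          of "\<lambda>x. dir_deriv v h x + dir_deriv v k x"])
      (use Suc in \<open>auto simp: times_differentiable_on_Suc\<close>)
  thus ?case using Suc.prems by (auto simp: times_differentiable_on_Suc)
qed simp

lemma times_differentiable_on_const: "times_differentiable_on n (\<lambda>x. c) S"
proof (induction n arbitrary: c)
  case (Suc n)
  have "dir_deriv v (\<lambda>x. c) = (\<lambda>x. 0)" for v :: 'a
    by (auto simp: dir_deriv_def)
  thus ?case using Suc by (auto simp: times_differentiable_on_Suc)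
qed simp

lemma times_differentiable_on_sum:
  assumes "open S" "finite I" "\<And>i. i \<in> I \<Longrightarrow> times_differentiable_on n (h i) S"
  shows "times_differentiable_on n (\<lambda>x. \<Sum>i\<in>I. h i x) S"
  using assms(2,3)
  by (induction I) (auto intro!: times_differentiable_on_const times_differentiable_on_add[OF assms(1)])

lemma times_differentiable_on_bounded_linear:
  assumes "open S" "bounded_linear L" "times_differentiable_on n h S"
  shows "times_differentiable_on n (\<lambda>x. L (h x)) S"
  using assms(3)
proof (induction n arbitrary: h)
  case (Suc n)
  have L: "((\<lambda>x. L (h x)) has_derivative (\<lambda>v. L (dir_deriv v h x))) (at x)" if "x \<in> S" for x
    using Suc.prems that
    by (auto simp: times_differentiable_on_Suc
        intro!: bounded_linear.has_derivative[OF assms(2)] has_derivative_dir_deriv)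
  have "times_differentiable_on n (dir_deriv v (\<lambda>x. L (h x))) S" for v
    by (rule times_differentiable_on_cong[OF assms(1), of "\<lambda>x. L (dir_deriv v h x)"])
      (use Suc in \<open>auto simp: times_differentiable_on_Suc dir_deriv_eqI[OF L]\<close>)
  thus ?case using L by (auto simp: times_differentiable_on_Suc differentiable_def)
qed simp

lemma times_differentiable_on_scaleR:
  assumes "open S" "times_differentiable_on n c S" "times_differentiable_on n h S"
  shows "times_differentiable_on n (\<lambda>x. c x *\<^sub>R h x) S"
  using assms(2,3)
proof (induction n arbitrary: c h)
  case (Suc n)
  have D: "((\<lambda>x. c x *\<^sub>R h x) has_derivative
      (\<lambda>v. c x *\<^sub>R dir_deriv v h x + dir_deriv v c x *\<^sub>R h x)) (at x)" if "x \<in> S" for x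
    using Suc.prems that
    by (intro has_derivative_scaleR has_derivative_dir_deriv)
      (auto simp: times_differentiable_on_Suc)
  have "times_differentiable_on n (dir_deriv v (\<lambda>x. c x *\<^sub>R h x)) S" for v
  proof (rule times_differentiable_on_cong[OF assms(1)])
    show "times_differentiable_on n (\<lambda>x. c x *\<^sub>R dir_deriv v h x + dir_deriv v c x *\<^sub>R h x) S"
      using Suc.prems times_differentiable_on_mono[OF Suc.prems(1), of n]
        times_differentiable_on_mono[OF Suc.prems(2), of n]
      by (intro times_differentiable_on_add assms(1) Suc.IH)
        (auto simp: times_differentiable_on_Suc)
  qed (simp add: dir_deriv_eqI[OF D])
  thus ?case using D by (auto simp: times_differentiable_on_Suc differentiable_def)
qed simp

text \<open>The derivative of the composition along \<open>v\<close> is the derivative of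
  \<open>f\<close> at \<open>g x\<close> in the moving direction \<open>dir_deriv v g x\<close>.
  Expanded in the basis, it becomes a sum of products of components of \<open>dir_deriv v g\<close>
  with the maps \<open>dir_deriv b f\<close> composed with \<open>g\<close>, and the latter fall
  under the induction hypothesis.\<close>

lemma times_differentiable_on_compose:
  fixes g :: "'a::euclidean_space \<Rightarrow> 'b::euclidean_space"
  assumes "open S" "open T" "g ` S \<subseteq> T"
    and "times_differentiable_on n g S" "times_differentiable_on n f T"
  shows "times_differentiable_on n (\<lambda>x. f (g x)) S"
  using assms(4,5)
proof (induction n arbitrary: f)
  case (Suc n)
  have D: "((\<lambda>x. f (g x)) has_derivative (\<lambda>v. dir_deriv (dir_deriv v g x) f (g x))) (at x)"
    if "x \<in> S" for x
    using Suc.prems that assms(3)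
    by (intro has_derivative_compose[of g _ x UNIV f] has_derivative_dir_deriv)
      (auto simp: times_differentiable_on_Suc)
  have "times_differentiable_on n (dir_deriv v (\<lambda>x. f (g x))) S" for v
  proof (rule times_differentiable_on_cong[OF assms(1)])
    show "times_differentiable_on n
        (\<lambda>x. \<Sum>b\<in>Basis. (dir_deriv v g x \<bullet> b) *\<^sub>R dir_deriv b f (g x)) S"
      using Suc.prems times_differentiable_on_mono[of "Suc n" g S n]
      by (intro times_differentiable_on_sum times_differentiable_on_scaleR Suc.IH assms(1)
          times_differentiable_on_bounded_linear[OF _ bounded_linear_inner_left])
        (auto simp: times_differentiable_on_Suc)
    fix x assume "x \<in> S"
    thus "(\<Sum>b\<in>Basis. (dir_deriv v g x \<bullet> b) *\<^sub>R dir_deriv b f (g x)) =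
        dir_deriv v (\<lambda>x. f (g x)) x"
      using D[of x] Suc.prems assms(3)
      by (subst dir_deriv_basis_expansion[symmetric])
        (auto simp: dir_deriv_eqI times_differentiable_on_Suc)
  qed
  thus ?case using D by (auto simp: times_differentiable_on_Suc differentiable_def)
qed simp

subsection \<open>Iterated directional derivatives\<close>

text \<open>\<open>fold dir_deriv vs h\<close> differentiates along the first vector of \<open>vs\<close> first.\<close>

lemma times_differentiable_on_fold_dir_deriv:
  "times_differentiable_on (length vs + m) h S \<Longrightarrow>
    times_differentiable_on m (fold dir_deriv vs h) S"
  by (induction vs arbitrary: h) (auto simp: times_differentiable_on_Suc)

lemma fold_dir_deriv_cong:
  assumes "open S" "x \<in> S" "\<And>y. y \<in> S \<Longrightarrow> h y = h' y"
  shows "fold dir_deriv vs h x = fold dir_deriv vs h' x"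
  using assms(2,3)
proof (induction vs arbitrary: h h')
  case (Cons v vs)
  show ?case
    by (simp, rule Cons.IH) (use Cons.prems assms(1) in \<open>auto intro: dir_deriv_cong\<close>)
qed simp

lemma fold_dir_deriv_scaleR_sum:
  assumes "open S" "x \<in> S" "\<And>i. i \<in> I \<Longrightarrow> times_differentiable_on (length vs) (h i) S"
  shows "fold dir_deriv vs (\<lambda>y. \<Sum>i\<in>I. c i *\<^sub>R h i y) x =
    (\<Sum>i\<in>I. c i *\<^sub>R fold dir_deriv vs (h i) x)"
  using assms(3)
proof (induction vs arbitrary: h)
  case (Cons v vs)
  have "fold dir_deriv (v # vs) (\<lambda>y. \<Sum>i\<in>I. c i *\<^sub>R h i y) x =
      fold dir_deriv vs (\<lambda>y. \<Sum>i\<in>I. c i *\<^sub>R dir_deriv v (h i) y) x"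
    using Cons.prems
    by (simp, intro fold_dir_deriv_cong[OF assms(1,2)] dir_deriv_scaleR_sum)
      (auto simp: times_differentiable_on_Suc)
  also have "\<dots> = (\<Sum>i\<in>I. c i *\<^sub>R fold dir_deriv (v # vs) (h i) x)"
    using Cons by (simp add: times_differentiable_on_Suc)
  finally show ?case .
qed simp

text \<open>The coefficients of the constant vector \<open>v\<close> pass through the remaining
  derivatives. Applied pointwise, this isolates one varying direction as a scalar factor.\<close>

lemma fold_dir_deriv_Cons_basis:
  fixes f :: "'a::euclidean_space \<Rightarrow> 'b::real_normed_vector"
  assumes "open S" "x \<in> S" "times_differentiable_on (Suc (length vs)) f S"
  shows "fold dir_deriv (v # vs) f x =
    (\<Sum>b\<in>Basis. (v \<bullet> b) *\<^sub>R fold dir_deriv (b # vs) f x)"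
proof -
  have "fold dir_deriv (v # vs) f x =
      fold dir_deriv vs (\<lambda>y. \<Sum>b\<in>Basis. (v \<bullet> b) *\<^sub>R dir_deriv b f y) x"
    using assms(3)
    by (simp, intro fold_dir_deriv_cong[OF assms(1,2)] dir_deriv_basis_expansion)
      (auto simp: times_differentiable_on_Suc)
  also have "\<dots> = (\<Sum>b\<in>Basis. (v \<bullet> b) *\<^sub>R fold dir_deriv (b # vs) f x)"
    using assms(3)
    by (subst fold_dir_deriv_scaleR_sum[OF assms(1,2)]) (auto simp: times_differentiable_on_Suc)
  finally show ?thesis .
qed

text \<open>
  The second difference is symmetric in \<open>u\<close> and \<open>v\<close>, so its limit yields Schwarz's theorem without
  continuity of the second derivatives.
\<close>

lemma second_difference_tendsto:
  fixes h :: "'a::real_normed_vector \<Rightarrow> real"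
  assumes "open S" "x \<in> S" and diff: "\<And>y. y \<in> S \<Longrightarrow> h differentiable at y"
    and diff2: "dir_deriv u h differentiable at x"
  shows "((\<lambda>t. (h (x + t *\<^sub>R u + t *\<^sub>R v) - h (x + t *\<^sub>R u) - h (x + t *\<^sub>R v) + h x) / t\<^sup>2)
    \<longlongrightarrow> dir_deriv v (dir_deriv u h) x) (at_right 0)"
proof (rule tendstoI)
  fix e :: real assume e: "e > 0"
  \<comment> \<open>The two remainders below add up to at most
    \<open>e / C * t * (2 * norm u + norm v)\<close>; the extra 1 makes \<open>C\<close> positive
    and the final estimate strict.\<close>
  define C where "C = 2 * norm u + norm v + 1"
  have C: "C > 0" by (simp add: C_def add_nonneg_pos)
  define D where "D = (\<lambda>w. dir_deriv w (dir_deriv u h) x)"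
  have D: "(dir_deriv u h has_derivative D) (at x)"
    unfolding D_def by (rule has_derivative_dir_deriv[OF diff2])
  interpret D: bounded_linear D using D by (rule has_derivative_bounded_linear)
  obtain d where d: "d > 0" "\<And>z. norm (z - x) < d \<Longrightarrow>
      \<bar>dir_deriv u h z - dir_deriv u h x - D (z - x)\<bar> \<le> e / C * norm (z - x)"
    using D e C unfolding has_derivative_at_alt by (metis divide_pos_pos real_norm_def)
  obtain r where r: "r > 0" "ball x r \<subseteq> S"
    using assms(1,2) openE by blast
  \<comment> \<open>For \<open>t < t0\<close> all points involved lie in the ball inside
    \<open>S\<close> and within the radius \<open>d\<close> of the first-order expansion.\<close>
  define t0 where "t0 = min d r / C"
  have t0: "t0 > 0" using d r C by (simp add: t0_def)
  have "dist ((h (x + t *\<^sub>R u + t *\<^sub>R v) - h (x + t *\<^sub>R u) - h (x + t *\<^sub>R v) + h x) / t\<^sup>2)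
      (D v) < e" if t: "0 < t" "t < t0" for t
  proof -
    have tC: "t * C < d" "t * C < r"
      using t C by (auto simp: t0_def pos_less_divide_eq)
    have near: "norm (s *\<^sub>R u + c *\<^sub>R v) \<le> t * (norm u + norm v)"
      "norm (s *\<^sub>R u + c *\<^sub>R v) < t * C"
      if "0 \<le> s" "s \<le> t" "c = 0 \<or> c = t" for s c
    proof -
      have "norm (s *\<^sub>R u + c *\<^sub>R v) \<le> s * norm u + c * norm v"
        using that t norm_triangle_ineq[of "s *\<^sub>R u" "c *\<^sub>R v"] by auto
      also have "\<dots> \<le> t * norm u + t * norm v"
        using that t by (intro add_mono mult_right_mono) auto
      finally show *: "norm (s *\<^sub>R u + c *\<^sub>R v) \<le> t * (norm u + norm v)"
        by (simp add: algebra_simps)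
      also have "\<dots> < t * C" using t by (simp add: C_def add_nonneg_pos)
      finally show "norm (s *\<^sub>R u + c *\<^sub>R v) < t * C" .
    qed
    \<comment> \<open>\<open>p t - p 0\<close> is the second difference. The mean value theorem in
      \<open>s\<close> turns it into \<open>t\<close> times a difference of two values of
      \<open>dir_deriv u h\<close>.\<close>
    define p where "p = (\<lambda>s. h (x + s *\<^sub>R u + t *\<^sub>R v) - h (x + s *\<^sub>R u))"
    have inS: "x + (s *\<^sub>R u + c *\<^sub>R v) \<in> S" if "0 \<le> s" "s \<le> t" "c = 0 \<or> c = t" for s c
    proof -
      have "dist x (x + z) = norm z" for z :: 'a by (simp add: dist_norm)
      hence "x + (s *\<^sub>R u + c *\<^sub>R v) \<in> ball x r"
        using less_trans[OF near(2)[OF that] tC(2)] by (simp only: mem_ball)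
      thus ?thesis using r(2) by blast
    qed
    have hd: "((\<lambda>s. h (x + (s *\<^sub>R u + c *\<^sub>R v))) has_real_derivative
        dir_deriv u h (x + (s *\<^sub>R u + c *\<^sub>R v))) (at s)"
      if "0 \<le> s" "s \<le> t" "c = 0 \<or> c = t" for s c
    proof -
      let ?y = "x + (s *\<^sub>R u + c *\<^sub>R v)"
      have h': "(h has_derivative (\<lambda>w. dir_deriv w h ?y)) (at ?y)"
        by (rule has_derivative_dir_deriv[OF diff[OF inS[OF that]]])
      have "((\<lambda>s. x + (s *\<^sub>R u + c *\<^sub>R v)) has_derivative (\<lambda>k. k *\<^sub>R u)) (at s)"
        by (auto intro!: derivative_eq_intros)
      from has_derivative_compose[OF this h']
      have "((\<lambda>s. h (x + (s *\<^sub>R u + c *\<^sub>R v))) has_derivative (\<lambda>k. dir_deriv (k *\<^sub>R u) h ?y)) (at s)" .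
      moreover have "(\<lambda>k. dir_deriv (k *\<^sub>R u) h ?y) = (*) (dir_deriv u h ?y)"
        using linear_scale[OF has_derivative_linear[OF h']] by (auto simp: fun_eq_iff)
      ultimately show ?thesis by (simp add: has_field_derivative_def)
    qed
    have "(p has_real_derivative
        dir_deriv u h (x + (s *\<^sub>R u + t *\<^sub>R v)) - dir_deriv u h (x + (s *\<^sub>R u + 0 *\<^sub>R v))) (at s)"
      if "0 \<le> s" "s \<le> t" for s
      using DERIV_diff[OF hd[of s t] hd[of s 0]] that by (simp add: p_def add.assoc)
    from MVT2[OF t(1) this] obtain z where z: "0 < z" "z < t"
      and pz: "p t - p 0 = (t - 0) * (dir_deriv u h (x + (z *\<^sub>R u + t *\<^sub>R v)) -
        dir_deriv u h (x + (z *\<^sub>R u + 0 *\<^sub>R v)))"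
      by auto
    \<comment> \<open>The remainder of the first-order expansion of \<open>dir_deriv u h\<close> at
      \<open>x\<close>. In \<open>q t - q 0\<close> the linear contributions of
      \<open>z *\<^sub>R u\<close> cancel, leaving only \<open>D (t *\<^sub>R v)\<close>.\<close>
    define q where "q = (\<lambda>c. dir_deriv u h (x + (z *\<^sub>R u + c *\<^sub>R v)) - dir_deriv u h x - D (z *\<^sub>R u + c *\<^sub>R v))"
    have q: "\<bar>q c\<bar> \<le> e / C * norm (z *\<^sub>R u + c *\<^sub>R v)" if "c = 0 \<or> c = t" for c
      using d(2)[of "x + (z *\<^sub>R u + c *\<^sub>R v)"] near(2)[of z c] tC z that by (simp add: q_def)
    have qt: "\<bar>q t\<bar> \<le> e / C * (t * (norm u + norm v))"
      using q[of t] near(1)[of z t] z e C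
      by (intro order_trans[OF q[of t]] mult_left_mono) auto
    have q0: "\<bar>q 0\<bar> \<le> e / C * (t * norm u)"
      using z e C
      by (intro order_trans[OF q[of 0]] mult_left_mono) (auto intro!: mult_right_mono)
    have "p t - p 0 = t * (D (t *\<^sub>R v) + (q t - q 0))"
      unfolding pz q_def by (simp add: D.add)
    hence "p t - p 0 = t\<^sup>2 * (D v + (q t - q 0) / t)"
      using t by (simp add: D.scaleR distrib_left power2_eq_square)
    hence "(p t - p 0) / t\<^sup>2 - D v = (q t - q 0) / t"
      using t by simp
    moreover have "\<bar>q t - q 0\<bar> < e * t"
    proof -
      have "\<bar>q t - q 0\<bar> \<le> e / C * (t * (norm u + norm v)) + e / C * (t * norm u)"
        using qt q0 by linarith
      also have "\<dots> = e / C * t * (2 * norm u + norm v)"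
        unfolding mult.assoc distrib_left[symmetric] by (simp add: algebra_simps)
      also have "\<dots> = e / C * t * (C - 1)" by (simp add: C_def)
      also have "\<dots> < e / C * t * C"
        using e C t by (intro mult_strict_left_mono) auto
      also have "\<dots> = e * t" using C by simp
      finally show ?thesis .
    qed
    ultimately have "\<bar>(p t - p 0) / t\<^sup>2 - D v\<bar> < e"
      using t by (simp only: abs_divide) (simp add: pos_divide_less_eq)
    thus ?thesis by (simp add: p_def dist_real_def algebra_simps)
  qed
  thus "\<forall>\<^sub>F t in at_right 0. dist ((h (x + t *\<^sub>R u + t *\<^sub>R v) - h (x + t *\<^sub>R u) -
      h (x + t *\<^sub>R v) + h x) / t\<^sup>2) (dir_deriv v (dir_deriv u h) x) < e"
    unfolding D_def using t0 by (auto simp: eventually_at_right_field)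
qed

lemma dir_deriv_inner_left:
  "h differentiable at x \<Longrightarrow> dir_deriv v (\<lambda>y. h y \<bullet> b) x = dir_deriv v h x \<bullet> b"
  by (rule dir_deriv_eqI) (auto intro!: derivative_eq_intros has_derivative_dir_deriv)

text \<open>Taking the inner product with each basis vector reduces to the real-valued case, where
  both mixed derivatives are limits of the same second difference.\<close>

lemma dir_deriv_commute:
  fixes h :: "'a::real_normed_vector \<Rightarrow> 'b::euclidean_space"
  assumes "open S" "x \<in> S" and diff: "\<And>y. y \<in> S \<Longrightarrow> h differentiable at y"
    and diff2: "dir_deriv u h differentiable at x" "dir_deriv v h differentiable at x"
  shows "dir_deriv v (dir_deriv u h) x = dir_deriv u (dir_deriv v h) x"
proof (rule euclidean_eqI)
  fix b :: 'b
  define k where "k = (\<lambda>y. h y \<bullet> b)"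
  have kd: "k differentiable at y" if "y \<in> S" for y
    using diff[OF that] unfolding k_def differentiable_def by (blast intro: has_derivative_inner_left)
  have kd1: "dir_deriv w k y = dir_deriv w h y \<bullet> b" if "y \<in> S" for y w
    using diff[OF that] by (simp add: k_def dir_deriv_inner_left)
  have kd2: "dir_deriv w' (dir_deriv w k) x = dir_deriv w' (dir_deriv w h) x \<bullet> b"
    "dir_deriv w k differentiable at x"
    if "dir_deriv w h differentiable at x" for w w'
  proof -
    have *: "((\<lambda>y. dir_deriv w h y \<bullet> b) has_derivative (\<lambda>w'. dir_deriv w' (dir_deriv w h) x \<bullet> b)) (at x)"
      by (intro has_derivative_inner_left has_derivative_dir_deriv that)
    have **: "(dir_deriv w k has_derivative (\<lambda>w'. dir_deriv w' (dir_deriv w h) x \<bullet> b)) (at x)"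
      by (rule has_derivative_transform_within_open[OF * assms(1,2)]) (simp add: kd1)
    thus "dir_deriv w' (dir_deriv w k) x = dir_deriv w' (dir_deriv w h) x \<bullet> b"
      by (rule dir_deriv_eqI)
    show "dir_deriv w k differentiable at x" using ** by (auto simp: differentiable_def)
  qed
  have "dir_deriv v (dir_deriv u k) x = dir_deriv u (dir_deriv v k) x"
  proof (rule tendsto_unique)
    show "((\<lambda>t. (k (x + t *\<^sub>R u + t *\<^sub>R v) - k (x + t *\<^sub>R u) - k (x + t *\<^sub>R v) + k x) / t\<^sup>2)
        \<longlongrightarrow> dir_deriv v (dir_deriv u k) x) (at_right 0)"
      by (rule second_difference_tendsto[OF assms(1,2) kd kd2(2)[OF diff2(1)]])
    show "((\<lambda>t. (k (x + t *\<^sub>R u + t *\<^sub>R v) - k (x + t *\<^sub>R u) - k (x + t *\<^sub>R v) + k x) / t\<^sup>2)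
        \<longlongrightarrow> dir_deriv u (dir_deriv v k) x) (at_right 0)"
      using second_difference_tendsto[OF assms(1,2) kd kd2(2)[OF diff2(2)], of u]
      by (simp add: algebra_simps)
  qed simp
  thus "dir_deriv v (dir_deriv u h) x \<bullet> b = dir_deriv u (dir_deriv v h) x \<bullet> b"
    using kd2(1)[OF diff2(1)] kd2(1)[OF diff2(2)] by simp
qed

text \<open>Adjacent transpositions: the induction hypothesis brings \<open>v\<close> next to
  \<open>u\<close>, and the two innermost derivatives are then exchanged on all of \<open>S\<close>,
  which lets the outer derivatives follow.\<close>

lemma fold_dir_deriv_move_front:
  fixes h :: "'a::euclidean_space \<Rightarrow> 'b::euclidean_space"
  assumes "open S" "x \<in> S" "times_differentiable_on (length (us @ v # vs)) h S"
  shows "fold dir_deriv (us @ v # vs) h x = fold dir_deriv (v # us @ vs) h x"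
  using assms(3)
proof (induction us arbitrary: h)
  case (Cons u us)
  have "fold dir_deriv ((u # us) @ v # vs) h x = fold dir_deriv (v # us @ vs) (dir_deriv u h) x"
    using Cons by (simp add: times_differentiable_on_Suc)
  also have "\<dots> = fold dir_deriv (us @ vs) (dir_deriv v (dir_deriv u h)) x" by simp
  also have "\<dots> = fold dir_deriv (us @ vs) (dir_deriv u (dir_deriv v h)) x"
    using Cons.prems
    by (intro fold_dir_deriv_cong[OF assms(1,2)] dir_deriv_commute[OF assms(1)])
      (auto simp: times_differentiable_on_Suc)
  finally show ?case by simp
qed simp

lemma fold_dir_deriv_permute:
  fixes h :: "'a::euclidean_space \<Rightarrow> 'b::euclidean_space"
  assumes "open S" "x \<in> S" "times_differentiable_on (length vs) h S" "mset vs = mset ws"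
  shows "fold dir_deriv vs h x = fold dir_deriv ws h x"
  using assms(3,4)
proof (induction vs arbitrary: ws h)
  case (Cons v vs)
  have "v \<in> set ws" using Cons.prems(2) by (metis list.set_intros(1) mset_eq_setD)
  then obtain ws1 ws2 where ws: "ws = ws1 @ v # ws2" by (meson split_list)
  have len: "length (ws1 @ v # ws2) = length (v # vs)"
    using mset_eq_length[OF Cons.prems(2)] ws by simp
  have "fold dir_deriv ws h x = fold dir_deriv (ws1 @ ws2) (dir_deriv v h) x"
    using fold_dir_deriv_move_front[OF assms(1,2), of ws1 v ws2 h] Cons.prems(1) ws
    by (simp only: len) simp
  also have "\<dots> = fold dir_deriv vs (dir_deriv v h) x"
    using Cons ws by (intro Cons.IH[symmetric]) (auto simp: times_differentiable_on_Suc)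
  finally show ?case by simp
qed simp

text \<open>Chain and product rule for an iterated derivative of \<open>f\<close> at
  \<open>g y\<close> along moving directions \<open>w y\<close>. Differentiating the base point
  \<open>g y\<close> adds one outermost direction, hence the entry at the end of the list;
  differentiating a direction replaces it in place. The induction splits off the first direction by
  its basis expansion.\<close>

lemma has_derivative_fold_dir_deriv:
  fixes g :: "'a::euclidean_space \<Rightarrow> 'b::euclidean_space"
    and f :: "'b \<Rightarrow> 'c::real_normed_vector"
  assumes "open S" "x \<in> S" "open T" "g ` S \<subseteq> T" "g differentiable at x"
    and "\<And>w. w \<in> set ws \<Longrightarrow> w differentiable at x"
    and "times_differentiable_on (Suc (length ws)) f T"
  shows "((\<lambda>y. fold dir_deriv (map (\<lambda>w. w y) ws) f (g y)) has_derivative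
    (\<lambda>v. fold dir_deriv (map (\<lambda>w. w x) ws @ [dir_deriv v g x]) f (g x) +
      (\<Sum>r<length ws. fold dir_deriv ((map (\<lambda>w. w x) ws)[r := dir_deriv v (ws ! r) x]) f (g x))))
    (at x)"
  using assms(6,7)
proof (induction ws arbitrary: f)
  case Nil
  have "f differentiable at (g x)"
    using Nil assms(2,4) by (auto simp: times_differentiable_on_Suc)
  thus ?case
    using has_derivative_compose[OF has_derivative_dir_deriv[OF assms(5)] has_derivative_dir_deriv]
    by simp
next
  case (Cons w ws)
  let ?ws = "map (\<lambda>w. w x) ws"
  have gT: "g y \<in> T" if "y \<in> S" for y using that assms(4) by auto
  have tdf: "times_differentiable_on (Suc (length ws)) f T"
    using Cons.prems(2) times_differentiable_on_mono by fastforce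
  have tdb: "times_differentiable_on (Suc (length ws)) (dir_deriv b f) T" for b
    using Cons.prems(2) by (auto simp: times_differentiable_on_Suc)
  \<comment> \<open>Collapses a basis expansion. It is needed on all of \<open>S\<close>, because
    the function being differentiated is itself rewritten at the end.\<close>
  have expand: "(\<Sum>b\<in>Basis. (u \<bullet> b) *\<^sub>R fold dir_deriv us (dir_deriv b f) (g y)) =
      fold dir_deriv (u # us) f (g y)"
    if "y \<in> S" "length us \<le> Suc (length ws)" for u us y
    using fold_dir_deriv_Cons_basis[OF assms(3) gT[OF that(1)], of us f u]
      times_differentiable_on_mono[OF Cons.prems(2), of "Suc (length us)"] that by simp
  have "((\<lambda>y. \<Sum>b\<in>Basis. (w y \<bullet> b) *\<^sub>R fold dir_deriv (map (\<lambda>w. w y) ws) (dir_deriv b f) (g y))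
    has_derivative (\<lambda>v. \<Sum>b\<in>Basis.
      (w x \<bullet> b) *\<^sub>R (fold dir_deriv (?ws @ [dir_deriv v g x]) (dir_deriv b f) (g x) +
        (\<Sum>r<length ws. fold dir_deriv (?ws[r := dir_deriv v (ws ! r) x]) (dir_deriv b f) (g x))) +
      (dir_deriv v w x \<bullet> b) *\<^sub>R fold dir_deriv ?ws (dir_deriv b f) (g x))) (at x)"
    using Cons.prems
    by (intro has_derivative_sum has_derivative_scaleR Cons.IH tdb has_derivative_inner_left
        has_derivative_dir_deriv) auto
  also have "(\<lambda>v. \<Sum>b\<in>Basis.
      (w x \<bullet> b) *\<^sub>R (fold dir_deriv (?ws @ [dir_deriv v g x]) (dir_deriv b f) (g x) +
        (\<Sum>r<length ws. fold dir_deriv (?ws[r := dir_deriv v (ws ! r) x]) (dir_deriv b f) (g x))) +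
      (dir_deriv v w x \<bullet> b) *\<^sub>R fold dir_deriv ?ws (dir_deriv b f) (g x)) =
    (\<lambda>v. fold dir_deriv (w x # ?ws @ [dir_deriv v g x]) f (g x) +
      (\<Sum>r<length ws. fold dir_deriv (w x # ?ws[r := dir_deriv v (ws ! r) x]) f (g x)) +
      fold dir_deriv (dir_deriv v w x # ?ws) f (g x))"
    by (simp add: scaleR_add_right sum.distrib scaleR_sum_right sum.swap[of _ "{..<length ws}" Basis]
        expand assms(2) del: fold_simps fold.simps fold_append)
  also have "\<dots> = (\<lambda>v. fold dir_deriv (map (\<lambda>w. w x) (w # ws) @ [dir_deriv v g x]) f (g x) +
      (\<Sum>r<length (w # ws). fold dir_deriv
        ((map (\<lambda>w. w x) (w # ws))[r := dir_deriv v ((w # ws) ! r) x]) f (g x)))"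
    by (simp add: sum.lessThan_Suc_shift add.commute add.left_commute del: sum.lessThan_Suc)
  finally show ?case
    by (rule has_derivative_transform_within_open[OF _ assms(1,2)])
      (use expand in \<open>simp del: fold_simps fold.simps\<close>)
qed

subsection \<open>Higher derivatives of a composition\<close>

definition partition_msets :: "nat \<Rightarrow> nat multiset set" where
  "partition_msets n = {M. sum_mset M = n \<and> 0 \<notin># M}"

text \<open>For a partition \<open>M\<close> of \<open>n\<close>,
  \<open>fact n / bell_weight M\<close> is the number of set partitions of an
  \<open>n\<close>-element set with block sizes \<open>M\<close>.\<close>

definition bell_weight :: "nat multiset \<Rightarrow> real" where
  "bell_weight M = (\<Prod>l\<in>set_mset M. fact (count M l) * fact l ^ count M l)"

lemma bell_weight_superset:
  assumes "finite A" "set_mset M \<subseteq> A"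
  shows "bell_weight M = (\<Prod>l\<in>A. fact (count M l) * fact l ^ count M l)"
  unfolding bell_weight_def
  by (rule prod.mono_neutral_left) (use assms in \<open>auto simp: not_in_iff\<close>)

lemma bell_weight_pos: "bell_weight M > 0"
  unfolding bell_weight_def by (auto intro!: prod_pos)

text \<open>Only the factor of \<open>l\<close> changes: with \<open>c = count M l\<close> it passes
  from \<open>fact c * fact l ^ c\<close> to the same expression at \<open>c + 1\<close>. For
  \<open>l\<close> outside \<open>M\<close> the old factor is 1.\<close>

lemma bell_weight_add_mset:
  "bell_weight (add_mset l M) = bell_weight M * real (Suc (count M l)) * fact l"
proof -
  let ?A = "insert l (set_mset M)"
  have split: "bell_weight N = fact (count N l) * fact l ^ count N l *
      (\<Prod>i\<in>?A - {l}. fact (count N i) * fact i ^ count N i)" if "set_mset N \<subseteq> ?A" for N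
    using that by (simp only: bell_weight_superset[of ?A] finite_insert finite_set_mset)
      (simp add: prod.remove[of ?A l])
  have "(\<Prod>i\<in>?A - {l}. fact (count (add_mset l M) i) * fact i ^ count (add_mset l M) i) =
      (\<Prod>i\<in>?A - {l}. fact (count M i) * fact i ^ count M i :: real)"
    by (rule prod.cong) auto
  thus ?thesis
    unfolding split[of M, OF subset_insertI]
      split[of "add_mset l M", simplified set_mset_add_mset_insert, OF order_refl]
    by (simp del: insert_Diff_single)
qed

text \<open>Positive parts force the size to be at most the sum. Applied to \<open>M\<close> without
  \<open>l\<close>, this gives the upper bound on a part, which is the range of the indices in the
  Bell polynomials.\<close>

lemma partition_msets_bounds:
  assumes "M \<in> partition_msets n"
  shows "size M \<le> n" "\<And>l. l \<in># M \<Longrightarrow> 1 \<le> l \<and> l + size M \<le> Suc n"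
proof -
  have size: "size N \<le> sum_mset N" if "0 \<notin># N" for N :: "nat multiset"
    using that by (induction N) auto
  show "size M \<le> n" using size[of M] assms by (auto simp: partition_msets_def)
  fix l assume l: "l \<in># M"
  then obtain K where K: "M = add_mset l K" by (metis insert_DiffM)
  show "1 \<le> l \<and> l + size M \<le> Suc n"
    using size[of K] assms K by (auto simp: partition_msets_def)
qed

lemma finite_partition_msets: "finite (partition_msets n)"
proof (rule finite_subset)
  show "partition_msets n \<subseteq> mset ` {xs. set xs \<subseteq> {..n} \<and> length xs \<le> n}"
  proof
    fix M assume M: "M \<in> partition_msets n"
    obtain xs where xs: "M = mset xs" by (metis ex_mset)
    have "l \<le> n" if "l \<in># M" for l
      using partition_msets_bounds(2)[OF M that] that by (cases "size M") auto
    thus "M \<in> mset ` {xs. set xs \<subseteq> {..n} \<and> length xs \<le> n}"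
      using partition_msets_bounds(1)[OF M] xs by (auto intro!: imageI)
  qed
  show "finite (mset ` {xs. set xs \<subseteq> {..n} \<and> length xs \<le> n})"
    by (intro finite_imageI finite_lists_length_le) auto
qed

lemma partition_msets_0: "partition_msets 0 = {{#}}"
proof -
  have "M = {#}" if "sum_mset M = 0" "0 \<notin># M" for M :: "nat multiset"
    using that by (cases M) auto
  thus ?thesis by (auto simp: partition_msets_def)
qed

lemma sum_mset_image_scaleR_count:
  fixes G :: "'i \<Rightarrow> 'c::real_vector"
  assumes "finite A" "set_mset M \<subseteq> A"
  shows "(\<Sum>l\<in>#M. G l) = (\<Sum>l\<in>A. real (count M l) *\<^sub>R G l)"
  using assms(2)
proof (induction M)
  case (add a M)
  have "(\<Sum>l\<in>A. real (count (add_mset a M) l) *\<^sub>R G l) =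
      (\<Sum>l\<in>A. (if l = a then G l else 0) + real (count M l) *\<^sub>R G l)"
    by (rule sum.cong) (auto simp: algebra_simps)
  also have "\<dots> = G a + (\<Sum>l\<in>#M. G l)"
    using add assms(1) by (simp add: sum.distrib)
  finally show ?case by simp
qed simp

text \<open>
  Both sides are sums over the pairs \<open>(K, l)\<close> with \<open>\<Sum>K + l = n\<close>: differentiation turns
  \<open>K + {l}\<close> into \<open>K + {l + 1}\<close>, with \<open>l = 0\<close> standing for the new factor.
\<close>

lemma sum_partition_msets_Suc:
  fixes F :: "nat multiset \<Rightarrow> 'c::real_vector"
  shows "(\<Sum>M\<in>partition_msets n. (fact n / bell_weight M) *\<^sub>R
      (F (add_mset 1 M) + (\<Sum>l\<in>#M. F (add_mset (Suc l) (M - {#l#}))))) =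
    (\<Sum>N\<in>partition_msets (Suc n). (fact (Suc n) / bell_weight N) *\<^sub>R F N)"
proof -
  define Q where "Q = {(K, l). 0 \<notin># K \<and> sum_mset K + l = n}"
  \<comment> \<open>The common value of both sides: if \<open>M\<close> is \<open>K\<close> with a
    part \<open>l > 0\<close> added, then
    \<open>count M l / bell_weight M = 1 / (bell_weight K * fact l)\<close>; for
    \<open>l = 0\<close> the factor \<open>fact 0\<close> is 1.\<close>
  define H where "H = (\<lambda>(K, l). (fact n / (bell_weight K * fact l)) *\<^sub>R F (add_mset (Suc l) K))"
  have nz: "bell_weight K \<noteq> 0" for K using bell_weight_pos[of K] by simp
  \<comment> \<open>The index 0 is inserted to treat the new factor as the increment of an absent
    part: removing 0 from \<open>M\<close> changes nothing, and its multiplicity is set to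
    1.\<close>
  have "(\<Sum>M\<in>partition_msets n. (fact n / bell_weight M) *\<^sub>R
      (F (add_mset 1 M) + (\<Sum>l\<in>#M. F (add_mset (Suc l) (M - {#l#}))))) =
    (\<Sum>M\<in>partition_msets n. \<Sum>l\<in>insert 0 (set_mset M).
      (fact n / bell_weight M * (if l = 0 then 1 else real (count M l))) *\<^sub>R
        F (add_mset (Suc l) (M - {#l#})))"
  proof (rule sum.cong[OF refl])
    fix M assume "M \<in> partition_msets n"
    hence M: "0 \<notin># M" by (simp add: partition_msets_def)
    hence [simp]: "M - {#0#} = M" by (simp add: diff_single_trivial)
    have "(\<Sum>l\<in>set_mset M. real (count M l) *\<^sub>R F (add_mset (Suc l) (M - {#l#}))) =
        (\<Sum>l\<in>set_mset M. (if l = 0 then 1 else real (count M l)) *\<^sub>R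
          F (add_mset (Suc l) (M - {#l#})))"
      using M by (intro sum.cong) (auto simp: gr0_conv_Suc)
    moreover define c where "c = fact n / bell_weight M"
    ultimately show "(fact n / bell_weight M) *\<^sub>R
        (F (add_mset 1 M) + (\<Sum>l\<in>#M. F (add_mset (Suc l) (M - {#l#})))) =
      (\<Sum>l\<in>insert 0 (set_mset M).
        (fact n / bell_weight M * (if l = 0 then 1 else real (count M l))) *\<^sub>R
          F (add_mset (Suc l) (M - {#l#})))"
      using M unfolding c_def[symmetric]
      by (simp add: sum_mset_image_scaleR_count[of "set_mset M"] scaleR_add_right scaleR_sum_right)
  qed
  also have "\<dots> = (\<Sum>(M, l)\<in>(SIGMA M:partition_msets n. insert 0 (set_mset M)).
      (fact n / bell_weight M * (if l = 0 then 1 else real (count M l))) *\<^sub>R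
        F (add_mset (Suc l) (M - {#l#})))"
    by (rule sum.Sigma) (auto simp: finite_partition_msets)
  also have "\<dots> = sum H Q"
  proof (rule sum.reindex_bij_witness[of _
        "\<lambda>(K, l). (if l = 0 then K else add_mset l K, l)" "\<lambda>(M, l). (M - {#l#}, l)"])
    fix p assume "p \<in> (SIGMA M:partition_msets n. insert 0 (set_mset M))"
    then obtain M l where p: "p = (M, l)" and M: "sum_mset M = n" "0 \<notin># M" "l = 0 \<or> l \<in># M"
      by (auto simp: partition_msets_def)
    show "(case case p of (M, l) \<Rightarrow> (M - {#l#}, l) of
        (K, l) \<Rightarrow> (if l = 0 then K else add_mset l K, l)) = p"
      using M by (auto simp: p diff_single_trivial)
    show "(case p of (M, l) \<Rightarrow> (M - {#l#}, l)) \<in> Q"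
    proof (cases "l = 0")
      case False
      then obtain K where "M = add_mset l K" using M(3) by (metis insert_DiffM)
      thus ?thesis using M by (auto simp: p Q_def)
    qed (use M in \<open>auto simp: p Q_def diff_single_trivial\<close>)
    show "H (case p of (M, l) \<Rightarrow> (M - {#l#}, l)) = (case p of (M, l) \<Rightarrow>
        (fact n / bell_weight M * (if l = 0 then 1 else real (count M l))) *\<^sub>R
          F (add_mset (Suc l) (M - {#l#})))"
    proof (cases "l = 0")
      case False
      then obtain K where "M = add_mset l K" using M(3) by (metis insert_DiffM)
      thus ?thesis using False nz[of K]
        by (simp add: p H_def bell_weight_add_mset del: of_nat_Suc)
    qed (use M in \<open>auto simp: p H_def diff_single_trivial\<close>)
  next
    fix p assume "p \<in> Q"
    then obtain K l where p: "p = (K, l)" and K: "0 \<notin># K" "sum_mset K + l = n"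
      by (auto simp: Q_def)
    show "(case case p of (K, l) \<Rightarrow> (if l = 0 then K else add_mset l K, l) of
        (M, l) \<Rightarrow> (M - {#l#}, l)) = p"
      using K by (auto simp: p diff_single_trivial)
    show "(case p of (K, l) \<Rightarrow> (if l = 0 then K else add_mset l K, l)) \<in>
        (SIGMA M:partition_msets n. insert 0 (set_mset M))"
      using K by (auto simp: p partition_msets_def)
  qed
  \<comment> \<open>Now \<open>N\<close> is \<open>K\<close> with the part \<open>m = l + 1\<close>
    added; the quotient of \<open>fact m\<close> by \<open>fact l\<close> supplies the factor
    \<open>m\<close>.\<close>
  also have "\<dots> = (\<Sum>(N, m)\<in>(SIGMA N:partition_msets (Suc n). set_mset N).
      (fact n / bell_weight N * real (m * count N m)) *\<^sub>R F N)"
  proof (rule sum.reindex_bij_witness[of _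
        "\<lambda>(N, m). (N - {#m#}, m - 1)" "\<lambda>(K, l). (add_mset (Suc l) K, Suc l)"])
    fix p assume "p \<in> (SIGMA N:partition_msets (Suc n). set_mset N)"
    then obtain N m where p: "p = (N, m)" and N: "sum_mset N = Suc n" "0 \<notin># N" "m \<in># N"
      by (auto simp: partition_msets_def)
    then obtain K where K: "N = add_mset m K" by (metis insert_DiffM)
    show "(case case p of (N, m) \<Rightarrow> (N - {#m#}, m - 1) of
        (K, l) \<Rightarrow> (add_mset (Suc l) K, Suc l)) = p"
      using N K by (auto simp: p)
    show "(case p of (N, m) \<Rightarrow> (N - {#m#}, m - 1)) \<in> Q"
      using N K by (auto simp: p Q_def)
  next
    fix p assume "p \<in> Q"
    then obtain K l where p: "p = (K, l)" and K: "0 \<notin># K" "sum_mset K + l = n"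
      by (auto simp: Q_def)
    show "(case case p of (K, l) \<Rightarrow> (add_mset (Suc l) K, Suc l) of
        (N, m) \<Rightarrow> (N - {#m#}, m - 1)) = p"
      by (simp add: p)
    show "(case p of (K, l) \<Rightarrow> (add_mset (Suc l) K, Suc l)) \<in>
        (SIGMA N:partition_msets (Suc n). set_mset N)"
      using K by (auto simp: p partition_msets_def)
    show "(case case p of (K, l) \<Rightarrow> (add_mset (Suc l) K, Suc l) of
        (N, m) \<Rightarrow> (fact n / bell_weight N * real (m * count N m)) *\<^sub>R F N) = H p"
      using nz[of K] by (simp add: p H_def bell_weight_add_mset del: of_nat_Suc)
  qed
  also have "\<dots> = (\<Sum>N\<in>partition_msets (Suc n). \<Sum>m\<in>set_mset N.
      (fact n / bell_weight N * real (m * count N m)) *\<^sub>R F N)"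
    by (rule sum.Sigma[symmetric]) (auto simp: finite_partition_msets)
  also have "\<dots> = (\<Sum>N\<in>partition_msets (Suc n). (fact (Suc n) / bell_weight N) *\<^sub>R F N)"
  proof (rule sum.cong[OF refl])
    fix N assume "N \<in> partition_msets (Suc n)"
    \<comment> \<open>The parts of \<open>N\<close> counted with multiplicity sum to
      \<open>n + 1\<close>, which turns \<open>fact n\<close> into
      \<open>fact (Suc n)\<close>.\<close>
    hence "real (Suc n) = real (\<Sum>m\<in>#N. m)" by (simp add: partition_msets_def)
    also have "\<dots> = (\<Sum>m\<in>#N. real m)" by (simp add: of_nat_sum_mset)
    also have "\<dots> = (\<Sum>m\<in>set_mset N. real (m * count N m))"
      by (simp add: sum_mset_image_scaleR_count[of "set_mset N"] mult.commute)
    finally have "(\<Sum>m\<in>set_mset N. real (m * count N m)) = real (Suc n)" by (rule sym)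
    thus "(\<Sum>m\<in>set_mset N. (fact n / bell_weight N * real (m * count N m)) *\<^sub>R F N) =
        (fact (Suc n) / bell_weight N) *\<^sub>R F N"
      by (simp only: scaleR_sum_left[symmetric] sum_distrib_left[symmetric])
        (simp add: mult.commute)
  qed
  finally show ?thesis .
qed

text \<open>The sorted list merely picks an order of the directions; symmetry of the derivatives of
  \<open>f\<close> makes it immaterial where \<open>f\<close> is differentiable often
  enough.\<close>

definition bell_term ::
  "('a::real_normed_vector \<Rightarrow> 'b::real_normed_vector) \<Rightarrow> ('b \<Rightarrow> 'c::real_normed_vector) \<Rightarrow> 'a \<Rightarrow>
    nat multiset \<Rightarrow> 'a \<Rightarrow> 'c" where
  "bell_term g f v M x =
     fold dir_deriv (map (\<lambda>l. (dir_deriv v ^^ l) g x) (sorted_list_of_multiset M)) f (g x)"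

lemma bell_term_mset:
  fixes f :: "'b::euclidean_space \<Rightarrow> 'c::euclidean_space"
  assumes "open T" "g x \<in> T" "times_differentiable_on (length ls) f T"
  shows "bell_term g f v (mset ls) x = fold dir_deriv (map (\<lambda>l. (dir_deriv v ^^ l) g x) ls) f (g x)"
  unfolding bell_term_def
  by (rule fold_dir_deriv_permute[OF assms(1,2), symmetric])
    (use assms(3) in \<open>simp_all add: mset_map\<close>)

lemma times_differentiable_on_funpow_dir_deriv:
  "times_differentiable_on (l + m) h S \<Longrightarrow> times_differentiable_on m ((dir_deriv v ^^ l) h) S"
  using times_differentiable_on_fold_dir_deriv[of "replicate l v" m h S]
  by (simp add: fold_replicate)

text \<open>The chain and product rule for lists, with the resulting lists read as multisets again.
  Parts and size of \<open>M\<close> are at most \<open>n\<close>, so \<open>n + 1\<close> orders of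
  differentiability leave room for one more derivative of each factor.\<close>

lemma has_derivative_bell_term:
  fixes g :: "'a::euclidean_space \<Rightarrow> 'b::euclidean_space"
    and f :: "'b \<Rightarrow> 'c::euclidean_space"
  assumes "open S" "x \<in> S" "open T" "g ` S \<subseteq> T"
    and "times_differentiable_on (Suc n) g S" "times_differentiable_on (Suc n) f T"
    and M: "M \<in> partition_msets n"
  shows "bell_term g f v M differentiable at x"
    and "dir_deriv v (bell_term g f v M) x = bell_term g f v (add_mset 1 M) x +
      (\<Sum>l\<in>#M. bell_term g f v (add_mset (Suc l) (M - {#l#})) x)"
proof -
  define L where "L = sorted_list_of_multiset M"
  define w where "w = (\<lambda>l. (dir_deriv v ^^ l) g)"
  have msetL: "mset L = M" and lenL: "length L = size M"
    by (simp_all add: L_def flip: size_mset)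
  have gx: "g x \<in> T" using assms(2,4) by auto
  have w: "w l differentiable at x" if "l \<le> n" for l
    using times_differentiable_on_mono[OF assms(5), of "l + 1"] that assms(2)
    unfolding w_def
    by (intro times_differentiable_on_imp_differentiable[of 1 _ S]
        times_differentiable_on_funpow_dir_deriv) auto
  have le: "l \<le> n" if "l \<in> set L" for l
    using partition_msets_bounds(2)[OF M, of l] that msetL by (cases "size M") auto
  have f: "times_differentiable_on k f T" if "k \<le> Suc (size M)" for k
    using times_differentiable_on_mono[OF assms(6)] partition_msets_bounds(1)[OF M] that by simp
  have D: "(bell_term g f v M has_derivative
    (\<lambda>u. fold dir_deriv (map (\<lambda>l. w l x) L @ [dir_deriv u g x]) f (g x) +
      (\<Sum>r<length L. fold dir_deriv ((map (\<lambda>l. w l x) L)[r := dir_deriv u (w (L ! r)) x]) f (g x))))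
    (at x)"
  proof -
    have "g differentiable at x" using w[of 0] by (simp add: w_def)
    moreover have "u differentiable at x" if "u \<in> set (map w L)" for u
      using le w that by auto
    moreover have "times_differentiable_on (Suc (length (map w L))) f T"
      by (simp add: f lenL)
    ultimately show ?thesis
      using has_derivative_fold_dir_deriv[OF assms(1-4), of "map w L" f]
      by (simp add: bell_term_def[abs_def] w_def comp_def flip: L_def)
  qed
  thus "bell_term g f v M differentiable at x" by (auto simp: differentiable_def)
  have t: "fold dir_deriv (map (\<lambda>l. w l x) ls) f (g x) = bell_term g f v (mset ls) x"
    if "length ls \<le> Suc (size M)" for ls
    unfolding w_def by (rule bell_term_mset[where g = g and x = x, OF assms(3) gx f[OF that], symmetric])
  have "dir_deriv v (bell_term g f v M) x = fold dir_deriv (map (\<lambda>l. w l x) (L @ [1])) f (g x) +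
      (\<Sum>r<length L. fold dir_deriv (map (\<lambda>l. w l x) (L[r := Suc (L ! r)])) f (g x))"
    unfolding dir_deriv_eqI[OF D] by (simp add: w_def map_update)
  also have "\<dots> = bell_term g f v (add_mset 1 M) x +
      (\<Sum>r<length L. bell_term g f v (add_mset (Suc (L ! r)) (M - {#L ! r#})) x)"
    by (simp only: t length_append length_list_update lenL list.size)
      (simp add: mset_update lenL msetL)
  \<comment> \<open>Positions in the list count every part with its multiplicity, as the multiset
    sum does.\<close>
  also have "(\<Sum>r<length L. bell_term g f v (add_mset (Suc (L ! r)) (M - {#L ! r#})) x) =
      (\<Sum>l\<in>#M. bell_term g f v (add_mset (Suc l) (M - {#l#})) x)"
    by (simp only: msetL[symmetric] mset_map[symmetric] sum_mset_sum_list)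
      (simp add: sum_list_sum_nth atLeast0LessThan)
  finally show "dir_deriv v (bell_term g f v M) x = bell_term g f v (add_mset 1 M) x +
      (\<Sum>l\<in>#M. bell_term g f v (add_mset (Suc l) (M - {#l#})) x)" .
qed

text \<open>Faa di Bruno's formula along a fixed direction: differentiating each term raises one
  part or adjoins a 1, and \<open>sum_partition_msets_Suc\<close> recombines the
  coefficients.\<close>

lemma funpow_dir_deriv_compose:
  fixes g :: "'a::euclidean_space \<Rightarrow> 'b::euclidean_space"
    and f :: "'b \<Rightarrow> 'c::euclidean_space"
  assumes "open S" "open T" "g ` S \<subseteq> T"
    and "times_differentiable_on n g S" "times_differentiable_on n f T" "x \<in> S"
  shows "(dir_deriv v ^^ n) (f \<circ> g) x =
    (\<Sum>M\<in>partition_msets n. (fact n / bell_weight M) *\<^sub>R bell_term g f v M x)"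
  using assms(4-6)
proof (induction n arbitrary: x)
  case 0
  thus ?case by (simp add: partition_msets_0 bell_term_def bell_weight_def)
next
  case (Suc n)
  note D = has_derivative_bell_term[OF assms(1) Suc.prems(3) assms(2,3) Suc.prems(1,2)]
  have "(dir_deriv v ^^ Suc n) (f \<circ> g) x = dir_deriv v ((dir_deriv v ^^ n) (f \<circ> g)) x" by simp
  \<comment> \<open>The induction hypothesis holds throughout the open set \<open>S\<close>, so it
    may be differentiated at \<open>x\<close>.\<close>
  also have "\<dots> = dir_deriv v (\<lambda>y.
      \<Sum>M\<in>partition_msets n. (fact n / bell_weight M) *\<^sub>R bell_term g f v M y) x"
    by (rule dir_deriv_cong[OF assms(1) Suc.prems(3)], rule Suc.IH)
      (use Suc.prems times_differentiable_on_mono[of "Suc n" _ _ n] in auto)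
  also have "\<dots> = (\<Sum>M\<in>partition_msets n. (fact n / bell_weight M) *\<^sub>R
      (bell_term g f v (add_mset 1 M) x +
        (\<Sum>l\<in>#M. bell_term g f v (add_mset (Suc l) (M - {#l#})) x)))"
    by (subst dir_deriv_scaleR_sum) (simp_all add: D)
  also note sum_partition_msets_Suc[of n "\<lambda>M. bell_term g f v M x"]
  finally show ?case .
qed

subsection \<open>Kronecker products\<close>

lemma index_mult_mat_sum:
  assumes "A \<in> carrier_mat a b" "B \<in> carrier_mat b c" "i < a" "j < c"
  shows "(A * B) $$ (i, j) = (\<Sum>k<b. A $$ (i, k) * B $$ (k, j))"
  using assms by (simp add: scalar_prod_def lessThan_atLeast0)

lemma div_mod_bounds: "(i::nat) < a * b \<Longrightarrow> i div b < a \<and> i mod b < b"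
  by (cases "b = 0") (auto simp: less_mult_imp_div_less)

lemma sum_div_mod: "(\<Sum>k<a * b. F (k div b) (k mod b)) = (\<Sum>i<a. \<Sum>j<(b::nat). F i j)"
proof -
  have "(\<Sum>k<a * b. F (k div b) (k mod b)) = (\<Sum>(i, j)\<in>{..<a} \<times> {..<b}. F i j)"
  proof (rule sum.reindex_bij_witness[of _ "\<lambda>(i, j). i * b + j" "\<lambda>k. (k div b, k mod b)"])
    fix p assume "p \<in> {..<a} \<times> {..<b}"
    then obtain i j where p: "p = (i, j)" and i: "i < a" and j: "j < b" by auto
    have "i * b + j < Suc i * b" using j by simp
    also have "\<dots> \<le> a * b" using i by (intro mult_right_mono) auto
    finally show "(case p of (i, j) \<Rightarrow> i * b + j) \<in> {..<a * b}" by (simp add: p)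
    show "((case p of (i, j) \<Rightarrow> i * b + j) div b, (case p of (i, j) \<Rightarrow> i * b + j) mod b) = p"
      using j by (simp add: p)
  qed (auto dest: div_mod_bounds)
  thus ?thesis by (simp add: sum.cartesian_product)
qed

lemma dim_kron [simp]:
  "dim_row (kron A B) = dim_row A * dim_row B" "dim_col (kron A B) = dim_col A * dim_col B"
  by (simp_all add: kron_def)

lemma index_kron:
  assumes "B \<in> carrier_mat c d" "A \<in> carrier_mat a b" "i < a * c" "j < b * d"
  shows "kron A B $$ (i, j) = A $$ (i div c, j div d) * B $$ (i mod c, j mod d)"
  using assms by (simp add: kron_def)

text \<open>The mixed-product rule: the summation index splits into quotient and remainder modulo
  \<open>d\<close>, and the double sum factors into two matrix products.\<close>

lemma kron_mult:
  assumes "A \<in> carrier_mat a b" "B \<in> carrier_mat c d" "C \<in> carrier_mat b e" "D \<in> carrier_mat d f"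
  shows "kron A B * kron C D = kron (A * C) (B * D)"
proof (rule eq_matI)
  fix i j assume "i < dim_row (kron (A * C) (B * D))" "j < dim_col (kron (A * C) (B * D))"
  hence ij: "i < a * c" "j < e * f" using assms by auto
  note b = div_mod_bounds[OF ij(1)] div_mod_bounds[OF ij(2)]
  have "(kron A B * kron C D) $$ (i, j) =
      (\<Sum>k<b * d. (A $$ (i div c, k div d) * C $$ (k div d, j div f)) *
        (B $$ (i mod c, k mod d) * D $$ (k mod d, j mod f)))"
    unfolding index_mult_mat_sum[OF kron_carrier[OF assms(1,2)] kron_carrier[OF assms(3,4)] ij]
    by (rule sum.cong) (use ij in \<open>auto simp: index_kron[OF assms(2,1)] index_kron[OF assms(4,3)]\<close>)
  also have "\<dots> = (A * C) $$ (i div c, j div f) * (B * D) $$ (i mod c, j mod f)"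
    using b by (simp add: sum_div_mod[where F = "\<lambda>k l. (A $$ (i div c, k) * C $$ (k, j div f)) *
        (B $$ (i mod c, l) * D $$ (l, j mod f))"] sum_product
        index_mult_mat_sum[OF assms(1,3)] index_mult_mat_sum[OF assms(2,4)] del: index_mult_mat(1))
  also have "\<dots> = kron (A * C) (B * D) $$ (i, j)"
    using ij assms by (simp add: index_kron[of "B * D" c f "A * C" a e] del: index_mult_mat(1))
  finally show "(kron A B * kron C D) $$ (i, j) = kron (A * C) (B * D) $$ (i, j)" .
qed (use assms in auto)

lemma kron_assoc: "kron (kron A B) C = kron A (kron B C)"
proof (rule eq_matI)
  fix i j assume "i < dim_row (kron A (kron B C))" "j < dim_col (kron A (kron B C))"
  hence ij: "i < dim_row A * dim_row B * dim_row C" "j < dim_col A * dim_col B * dim_col C"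
    by (auto simp: mult.assoc)
  note b = div_mod_bounds[OF ij(1)] div_mod_bounds[OF ij(2)]
    div_mod_bounds[of i "dim_row A" "dim_row B * dim_row C"]
    div_mod_bounds[of j "dim_col A" "dim_col B * dim_col C"]
  \<comment> \<open>The mixed-radix digits of an index do not depend on how the digits are
    grouped.\<close>
  have *: "k div r div s = k div (s * r)" "k mod (s * r) div r = k div r mod s"
    "k mod (s * r) mod r = k mod r" for k r s :: nat
  proof -
    show "k div r div s = k div (s * r)" by (simp add: div_mult2_eq mult.commute)
    show "k mod (s * r) mod r = k mod r" by (simp add: mod_mod_cancel)
    show "k mod (s * r) div r = k div r mod s"
      by (cases "r = 0") (simp_all add: mult.commute[of s r] mod_mult2_eq)
  qed
  show "kron (kron A B) C $$ (i, j) = kron A (kron B C) $$ (i, j)"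
    using b ij by (simp add: kron_def * mult.assoc)
qed (simp_all add: mult.assoc)

lemma kron_one_left [simp]: "kron (1\<^sub>m (Suc 0)) A = A"
  by (rule eq_matI) (auto simp: kron_def)

lemma kron_one_right [simp]: "kron A (1\<^sub>m (Suc 0)) = A"
  by (rule eq_matI) (auto simp: kron_def)

lemma kron_smult: "kron (c \<cdot>\<^sub>m A) (d \<cdot>\<^sub>m B) = (c * d) \<cdot>\<^sub>m kron A B"
proof (rule eq_matI)
  fix i j assume "i < dim_row ((c * d) \<cdot>\<^sub>m kron A B)" "j < dim_col ((c * d) \<cdot>\<^sub>m kron A B)"
  hence "i < dim_row A * dim_row B" "j < dim_col A * dim_col B" by auto
  thus "kron (c \<cdot>\<^sub>m A) (d \<cdot>\<^sub>m B) $$ (i, j) = ((c * d) \<cdot>\<^sub>m kron A B) $$ (i, j)"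
    using div_mod_bounds[of i] div_mod_bounds[of j] by (simp add: kron_def)
qed simp_all

lemma kron_list_simps [simp]:
  "kron_list [] = 1\<^sub>m 1" "kron_list (A # As) = kron A (kron_list As)"
  by (simp_all add: kron_list_def)

lemma kron_list_append: "kron_list (As @ Bs) = kron (kron_list As) (kron_list Bs)"
  by (induction As) (simp_all add: kron_assoc)

lemma kron_pow_eq_kron_list: "kron_pow A m = kron_list (replicate m A)"
  by (induction m) simp_all

lemma kron_pow_add: "kron_pow A (m + n) = kron (kron_pow A m) (kron_pow A n)"
  by (simp add: kron_pow_eq_kron_list replicate_add kron_list_append)

lemma kron_pow_mult_exp: "kron_pow A (m * n) = kron_pow (kron_pow A n) m"
  by (induction m) (simp_all add: kron_pow_add)

lemma kron_pow_sum_list: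
  "kron_pow A (sum_list (map e ls)) = kron_list (map (\<lambda>l. kron_pow A (e l)) ls)"
  by (induction ls) (simp_all add: kron_pow_add)

lemma kron_list_mult:
  assumes "\<And>l. l \<in> set ls \<Longrightarrow> A l \<in> carrier_mat (a l) (b l)"
    and "\<And>l. l \<in> set ls \<Longrightarrow> B l \<in> carrier_mat (b l) (c l)"
  shows "kron_list (map A ls) * kron_list (map B ls) = kron_list (map (\<lambda>l. A l * B l) ls)"
  using assms
proof (induction ls)
  case (Cons l ls)
  have "kron_list (map A (l # ls)) * kron_list (map B (l # ls)) =
      kron (A l * B l) (kron_list (map A ls) * kron_list (map B ls))"
    unfolding list.map kron_list_simps
    by (rule kron_mult[OF Cons.prems(1)[of l] kron_list_carrier[of ls A a b]
          Cons.prems(2)[of l] kron_list_carrier[of ls B b c]]) (use Cons.prems in auto)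
  thus ?case using Cons by simp
qed simp

lemma kron_pow_mult:
  "A \<in> carrier_mat a b \<Longrightarrow> B \<in> carrier_mat b c \<Longrightarrow> kron_pow A m * kron_pow B m = kron_pow (A * B) m"
  using kron_list_mult[of "[0..<m]" "\<lambda>_. A" "\<lambda>_. a" "\<lambda>_. b" "\<lambda>_. B" "\<lambda>_. c"]
  by (simp add: kron_pow_eq_kron_list map_replicate_const)

lemma kron_pow_smult: "kron_pow (c \<cdot>\<^sub>m A) m = c ^ m \<cdot>\<^sub>m kron_pow A m"
  by (induction m) (auto simp: kron_smult)

lemma kron_list_smult:
  "kron_list (map (\<lambda>l. c l \<cdot>\<^sub>m A l) ls) = prod_list (map c ls) \<cdot>\<^sub>m kron_list (map A ls)"
  by (induction ls) (auto simp: kron_smult)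

text \<open>Flattens the blocks of equal factors into a single list, the form in which derivative
  matrices are contracted.\<close>

lemma kron_list_kron_pow:
  "kron_list (map (\<lambda>l. kron_pow (A l) (j l)) ls) =
    kron_list (map A (concat (map (\<lambda>l. replicate (j l) l) ls)))"
  by (induction ls) (simp_all add: kron_list_append kron_pow_eq_kron_list)

section \<open>Distributivity over finite matrix sums\<close>

lemma mult_mat_sum:
  assumes "A \<in> carrier_mat a r" "\<And>s. s \<in> S \<Longrightarrow> F s \<in> carrier_mat r c"
  shows "A * mat_sum r c F S = mat_sum a c (\<lambda>s. A * F s) S"
proof (rule eq_matI)
  fix i j assume "i < dim_row (mat_sum a c (\<lambda>s. A * F s) S)" "j < dim_col (mat_sum a c (\<lambda>s. A * F s) S)"
  hence ij: "i < a" "j < c" by (auto simp: mat_sum_def)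
  have "(A * mat_sum r c F S) $$ (i, j) = (\<Sum>k<r. \<Sum>s\<in>S. A $$ (i, k) * F s $$ (k, j))"
    using ij assms(1)
    by (subst index_mult_mat_sum[of _ a r _ c]) (auto simp: mat_sum_def sum_distrib_left)
  also have "\<dots> = (\<Sum>s\<in>S. (A * F s) $$ (i, j))"
    by (subst sum.swap) (simp add: index_mult_mat_sum[OF assms(1) assms(2) ij])
  finally show "(A * mat_sum r c F S) $$ (i, j) = mat_sum a c (\<lambda>s. A * F s) S $$ (i, j)"
    using ij by (simp add: mat_sum_def)
qed (use assms in \<open>auto simp: mat_sum_def\<close>)

lemma mat_sum_mult:
  assumes "\<And>s. s \<in> S \<Longrightarrow> F s \<in> carrier_mat a r" "B \<in> carrier_mat r c"
  shows "mat_sum a r F S * B = mat_sum a c (\<lambda>s. F s * B) S"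
proof (rule eq_matI)
  fix i j assume "i < dim_row (mat_sum a c (\<lambda>s. F s * B) S)" "j < dim_col (mat_sum a c (\<lambda>s. F s * B) S)"
  hence ij: "i < a" "j < c" by (auto simp: mat_sum_def)
  have "(mat_sum a r F S * B) $$ (i, j) = (\<Sum>k<r. \<Sum>s\<in>S. F s $$ (i, k) * B $$ (k, j))"
    using ij assms(2)
    by (subst index_mult_mat_sum[of _ a r _ c]) (auto simp: mat_sum_def sum_distrib_right)
  also have "\<dots> = (\<Sum>s\<in>S. (F s * B) $$ (i, j))"
    by (subst sum.swap) (simp add: index_mult_mat_sum[OF assms(1) assms(2) ij])
  finally show "(mat_sum a r F S * B) $$ (i, j) = mat_sum a c (\<lambda>s. F s * B) S $$ (i, j)"
    using ij by (simp add: mat_sum_def)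
qed (use assms in \<open>auto simp: mat_sum_def\<close>)

subsection \<open>Derivative matrices and directional derivatives\<close>

lemma partial_deriv_eq_dir_deriv:
  assumes "h differentiable at x"
  shows "partial_deriv i h x = dir_deriv (axis i 1) h x"
proof -
  let ?D = "\<lambda>v. dir_deriv v h x"
  have h: "(h has_derivative ?D) (at (x + 0 *\<^sub>R axis i 1))"
    using has_derivative_dir_deriv[OF assms] by simp
  have "((\<lambda>t. x + t *\<^sub>R axis i 1) has_derivative (\<lambda>t. t *\<^sub>R axis i 1)) (at 0)"
    by (auto intro!: derivative_eq_intros)
  from has_derivative_compose[OF this h]
  have "((\<lambda>t. h (x + t *\<^sub>R axis i 1)) has_derivative (\<lambda>t. ?D (t *\<^sub>R axis i 1))) (at 0)" .
  moreover have "(\<lambda>t. ?D (t *\<^sub>R axis i 1)) = (*) (?D (axis i 1))"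
    using linear_scale[OF has_derivative_linear[OF h]] by (auto simp: fun_eq_iff)
  ultimately show ?thesis
    by (auto simp: partial_deriv_def has_field_derivative_def intro!: DERIV_imp_deriv)
qed

lemma dir_deriv_eq_sum_partial_deriv:
  fixes h :: "real ^ 'n::{finite,linorder} \<Rightarrow> real"
  assumes "h differentiable at x"
  shows "dir_deriv v h x =
    (\<Sum>l<CARD('n). partial_deriv (nth_index l) h x * vec_nth v (nth_index l))"
proof -
  interpret linear "\<lambda>v. dir_deriv v h x"
    using has_derivative_dir_deriv[OF assms] by (rule has_derivative_linear)
  have "dir_deriv v h x = (\<Sum>i\<in>UNIV. vec_nth v i * dir_deriv (axis i 1) h x)"
    by (subst basis_expansion[of v, symmetric])
      (simp add: sum scaleR scalar_mult_eq_scaleR del: basis_expansion)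
  also have "\<dots> = (\<Sum>l<CARD('n). vec_nth v (nth_index l) * dir_deriv (axis (nth_index l) 1) h x)"
    by (rule sum.reindex_bij_betw[OF bij_betw_nth_index, symmetric])
  finally show ?thesis by (simp add: partial_deriv_eq_dir_deriv[OF assms] mult.commute)
qed

lemma index_deriv_mat_Suc:
  fixes h :: "real ^ 'n::{finite,linorder} \<Rightarrow> real ^ 'm::{finite,linorder}"
  assumes "i < CARD('m)" "c < CARD('n) ^ k * CARD('n)"
  shows "deriv_mat (Suc k) h x $$ (i, c) =
    partial_deriv (nth_index (c mod CARD('n))) (\<lambda>y. deriv_mat k h y $$ (i, c div CARD('n))) x"
proof -
  have "deriv_mat (Suc k) h x = mat_deriv (deriv_mat k h) x" by (simp add: deriv_mat_def)
  thus ?thesis using assms deriv_mat_carrier[of k h x] by (simp add: mat_deriv_def)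
qed

text \<open>On \<open>S\<close>, each entry of the next derivative matrix is a directional
  derivative of an earlier entry along a coordinate axis, so every step costs one order.\<close>

lemma times_differentiable_on_deriv_mat_entry:
  fixes h :: "real ^ 'n::{finite,linorder} \<Rightarrow> real ^ 'm::{finite,linorder}"
  assumes "open S" "times_differentiable_on (k + m) h S" "i < CARD('m)" "c < CARD('n) ^ k"
  shows "times_differentiable_on m (\<lambda>x. deriv_mat k h x $$ (i, c)) S"
  using assms(2,4)
proof (induction k arbitrary: m c)
  case 0
  thus ?case
    using times_differentiable_on_bounded_linear[OF assms(1) bounded_linear_vec_nth, of m h] assms(3)
    by (simp add: deriv_mat_def col_mat_def)
next
  case (Suc k)
  let ?e = "\<lambda>x. deriv_mat k h x $$ (i, c div CARD('n))"
  have c: "c < CARD('n) ^ k * CARD('n)" using Suc.prems(2) by (simp add: mult.commute)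
  have e: "times_differentiable_on (Suc m) ?e S"
    using Suc.prems(1) div_mod_bounds[OF c] by (intro Suc.IH) auto
  show ?case
    by (rule times_differentiable_on_cong[OF assms(1),
          of "dir_deriv (axis (nth_index (c mod CARD('n))) 1) ?e"])
      (use e in \<open>auto simp: index_deriv_mat_Suc[OF assms(3) c] times_differentiable_on_Suc
        partial_deriv_eq_dir_deriv\<close>)
qed

text \<open>The bridge between matrices and iterated directional derivatives.
  \<open>deriv_mat\<close> puts the newest derivative into the last column digit, so the induction
  appends at the end of the list.\<close>

lemma deriv_mat_mult_kron_list:
  fixes h :: "real ^ 'n::{finite,linorder} \<Rightarrow> real ^ 'm::{finite,linorder}"
  assumes "open S" "x \<in> S" "times_differentiable_on (length vs) h S"
  shows "deriv_mat (length vs) h x * kron_list (map col_mat vs) = col_mat (fold dir_deriv vs h x)"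
  using assms(2,3)
proof (induction vs arbitrary: x rule: rev_induct)
  case Nil
  show ?case by (simp add: deriv_mat_def col_mat_def)
next
  case (snoc v vs)
  let ?k = "length vs" and ?K = "kron_list (map col_mat vs)"
  let ?E = "\<lambda>i c y. deriv_mat ?k h y $$ (i, c)"
  have K: "?K \<in> carrier_mat (CARD('n) ^ ?k) 1"
    using kron_list_carrier[OF col_mat_carrier, of "\<lambda>v. v" vs]
    by (simp add: map_replicate_const)
  have KS: "kron_list (map col_mat (vs @ [v])) = kron ?K (col_mat v)"
    by (simp add: kron_list_append)
  have KSc: "kron ?K (col_mat v) \<in> carrier_mat (CARD('n) ^ ?k * CARD('n)) 1"
    using kron_carrier[OF K col_mat_carrier] by simp
  have KSi: "kron ?K (col_mat v) $$ (c, 0) =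
      ?K $$ (c div CARD('n), 0) * vec_nth v (nth_index (c mod CARD('n)))"
    if "c < CARD('n) ^ ?k * CARD('n)" for c
    using index_kron[OF col_mat_carrier K that, of 0 v] div_mod_bounds[OF that]
    by (simp add: col_mat_def)
  have S: "deriv_mat (Suc ?k) h x \<in> carrier_mat CARD('m) (CARD('n) ^ ?k * CARD('n))"
    using deriv_mat_carrier[of "Suc ?k" h x] by (simp add: mult.commute)
  have tdh: "times_differentiable_on ?k h S"
    using snoc.prems(2) times_differentiable_on_mono by fastforce
  have E: "?E i c differentiable at x" if "i < CARD('m)" "c < CARD('n) ^ ?k" for i c
    using times_differentiable_on_deriv_mat_entry[OF assms(1), of ?k 1 h i c] snoc.prems that
    by (simp add: times_differentiable_on_imp_differentiable[of 1 _ S])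
  have F: "fold dir_deriv vs h differentiable at x"
    using times_differentiable_on_fold_dir_deriv[of vs 1 h S] snoc.prems
    by (simp add: times_differentiable_on_imp_differentiable[of 1 _ S])
  show ?case
  proof (rule eq_matI)
    fix i j assume "i < dim_row (col_mat (fold dir_deriv (vs @ [v]) h x))"
      "j < dim_col (col_mat (fold dir_deriv (vs @ [v]) h x))"
    hence i: "i < CARD('m)" and [simp]: "j = 0" by (auto simp: col_mat_def)
    have "(deriv_mat (Suc ?k) h x * kron ?K (col_mat v)) $$ (i, 0) =
        (\<Sum>c<CARD('n) ^ ?k * CARD('n). ?K $$ (c div CARD('n), 0) *
          (partial_deriv (nth_index (c mod CARD('n))) (?E i (c div CARD('n))) x *
            vec_nth v (nth_index (c mod CARD('n)))))"
      by (subst index_mult_mat_sum[OF S KSc i], simp, rule sum.cong)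
        (auto simp: index_deriv_mat_Suc[OF i] KSi)
    \<comment> \<open>The last column digit runs over the coordinates of \<open>v\<close>; summing
      over it gives the derivative of an entry along \<open>v\<close>.\<close>
    also have "\<dots> = (\<Sum>c<CARD('n) ^ ?k. ?K $$ (c, 0) * dir_deriv v (?E i c) x)"
      by (subst sum_div_mod) (simp add: dir_deriv_eq_sum_partial_deriv E i flip: sum_distrib_left)
    \<comment> \<open>The entries of \<open>?K\<close> are constant in the point and move under the
      derivative.\<close>
    also have "\<dots> = dir_deriv v (\<lambda>y. \<Sum>c<CARD('n) ^ ?k. ?K $$ (c, 0) *\<^sub>R ?E i c y) x"
      by (subst dir_deriv_scaleR_sum) (simp_all add: E i)
    also have "\<dots> = dir_deriv v (\<lambda>y. vec_nth (fold dir_deriv vs h y) (nth_index i)) x"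
    proof (rule dir_deriv_cong[OF assms(1) snoc.prems(1)])
      fix y assume "y \<in> S"
      hence "deriv_mat ?k h y * ?K = col_mat (fold dir_deriv vs h y)" by (rule snoc.IH[OF _ tdh])
      hence "(deriv_mat ?k h y * ?K) $$ (i, 0) = vec_nth (fold dir_deriv vs h y) (nth_index i)"
        using i by (simp add: col_mat_def del: index_mult_mat(1))
      thus "(\<Sum>c<CARD('n) ^ ?k. ?K $$ (c, 0) *\<^sub>R ?E i c y) =
          vec_nth (fold dir_deriv vs h y) (nth_index i)"
        by (simp add: index_mult_mat_sum[OF deriv_mat_carrier K i] mult.commute del: index_mult_mat(1))
    qed
    also have "\<dots> = vec_nth (dir_deriv v (fold dir_deriv vs h) x) (nth_index i)"
      by (rule dir_deriv_eqI,
          rule bounded_linear.has_derivative[OF bounded_linear_vec_nth has_derivative_dir_deriv[OF F]])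
    finally show "(deriv_mat (length (vs @ [v])) h x * kron_list (map col_mat (vs @ [v]))) $$ (i, j) =
        col_mat (fold dir_deriv (vs @ [v]) h x) $$ (i, j)"
      using i unfolding KS by (simp add: col_mat_def)
  next
    show "dim_row (deriv_mat (length (vs @ [v])) h x * kron_list (map col_mat (vs @ [v]))) =
        dim_row (col_mat (fold dir_deriv (vs @ [v]) h x))"
      using S by (simp add: col_mat_def)
    show "dim_col (deriv_mat (length (vs @ [v])) h x * kron_list (map col_mat (vs @ [v]))) =
        dim_col (col_mat (fold dir_deriv (vs @ [v]) h x))"
      unfolding KS using carrier_matD(2)[OF KSc]
        carrier_matD(2)[OF col_mat_carrier, of "fold dir_deriv (vs @ [v]) h x"] by simp
  qed
qed

subsection \<open>Bell polynomials\<close>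

lemma prod_list_map_upt:
  "prod_list (map c [1..<N+2]) = (\<Prod>l=1..N+1. c l :: 'a::comm_monoid_mult)"
  unfolding prod.distinct_set_conv_list[OF distinct_upt, symmetric]
  by (rule arg_cong[where f = "prod c"]) auto

lemma sum_list_map_upt:
  "sum_list (map c [1..<N+2]) = (\<Sum>l=1..N+1. c l :: 'a::comm_monoid_add)"
  unfolding sum.distinct_set_conv_list[OF distinct_upt, symmetric]
  by (rule arg_cong[where f = "sum c"]) auto

lemma deriv_mat_mult_kron_pow:
  assumes "open S" "x \<in> S" "times_differentiable_on n h S"
  shows "deriv_mat n h x * kron_pow (col_mat dx) n = col_mat ((dir_deriv dx ^^ n) h x)"
  using deriv_mat_mult_kron_list[OF assms(1,2), of "replicate n dx" h] assms(3)
  by (simp add: kron_pow_eq_kron_list fold_replicate)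

text \<open>The partition encoded by \<open>j\<close>, listed in the order of the Kronecker factors
  of its Bell summand.\<close>

definition bell_list :: "nat \<Rightarrow> nat \<Rightarrow> (nat \<Rightarrow> nat) \<Rightarrow> nat list" where
  "bell_list n k j = concat (map (\<lambda>l. replicate (j l) l) [1..<n-k+2])"

lemma count_bell_list: "count (mset (bell_list n k j)) l = (if l \<in> {1..n-k+1} then j l else 0)"
proof -
  have "count (mset (concat (map (\<lambda>l. replicate (j l) l) ls))) l = (if l \<in> set ls then j l else 0)"
    if "distinct ls" for ls :: "nat list"
    using that by (induction ls) auto
  thus ?thesis by (auto simp: bell_list_def)
qed

lemma
  assumes "j \<in> bell_indices n k"
  shows length_bell_list: "length (bell_list n k j) = k"
    and sum_list_bell_list: "sum_list (bell_list n k j) = n"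
proof -
  have "length (concat (map (\<lambda>l. replicate (j l) l) ls)) = sum_list (map j ls)"
    and "sum_list (concat (map (\<lambda>l. replicate (j l) l) ls)) = sum_list (map (\<lambda>l. l * j l) ls)"
    for ls :: "nat list"
    by (induction ls) (simp_all add: sum_list_replicate)
  with assms show "length (bell_list n k j) = k" "sum_list (bell_list n k j) = n"
    by (simp_all only: bell_list_def sum_list_map_upt bell_indices_def mem_Collect_eq)
qed

lemma bell_weight_bell_list:
  "bell_weight (mset (bell_list n k j)) = (\<Prod>l=1..n-k+1. fact (j l) * fact l ^ j l)"
proof -
  have "set_mset (mset (bell_list n k j)) \<subseteq> {1..n-k+1}"
    by (auto simp: bell_list_def)
  hence "bell_weight (mset (bell_list n k j)) =
      (\<Prod>l=1..n-k+1. fact (count (mset (bell_list n k j)) l) *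
        fact l ^ count (mset (bell_list n k j)) l)"
    by (intro bell_weight_superset) auto
  also have "\<dots> = (\<Prod>l=1..n-k+1. fact (j l) * fact l ^ j l)"
    by (rule prod.cong) (auto simp: count_bell_list)
  finally show ?thesis .
qed

text \<open>A pair \<open>(k, j)\<close> corresponds to the partition in which \<open>l\<close>
  occurs \<open>j l\<close> times; \<open>k\<close> is recovered as its size and \<open>j\<close> as
  its multiplicities.\<close>

lemma sum_bell_indices:
  assumes "n \<ge> 1"
  shows "(\<Sum>k=1..n. \<Sum>j\<in>bell_indices n k. F (mset (bell_list n k j))) =
    (\<Sum>M\<in>partition_msets n. F M)"
proof -
  have "(\<Sum>k=1..n. \<Sum>j\<in>bell_indices n k. F (mset (bell_list n k j))) =
      (\<Sum>(k, j)\<in>(SIGMA k:{1..n}. bell_indices n k). F (mset (bell_list n k j)))"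
    by (rule sum.Sigma) (auto simp: finite_bell_indices)
  also have "\<dots> = (\<Sum>M\<in>partition_msets n. F M)"
  proof (rule sum.reindex_bij_witness[of _
        "\<lambda>M. (size M, restrict (count M) {1..n - size M + 1})"
        "\<lambda>(k, j). mset (bell_list n k j)"])
    fix p assume "p \<in> (SIGMA k:{1..n}. bell_indices n k)"
    then obtain k j where p: "p = (k, j)" and j: "j \<in> bell_indices n k" by auto
    have "restrict (count (mset (bell_list n k j))) {1..n-k+1} = j"
      using j by (auto simp: bell_indices_def count_bell_list PiE_def extensional_def fun_eq_iff)
    thus "(\<lambda>M. (size M, restrict (count M) {1..n - size M + 1}))
        (case p of (k, j) \<Rightarrow> mset (bell_list n k j)) = p"
      by (simp add: p length_bell_list[OF j])
    have "0 \<notin> set (bell_list n k j)" by (auto simp: bell_list_def)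
    thus "(case p of (k, j) \<Rightarrow> mset (bell_list n k j)) \<in> partition_msets n"
      by (simp add: p partition_msets_def sum_mset_sum_list sum_list_bell_list[OF j])
  next
    fix M assume M: "M \<in> partition_msets n"
    let ?N = "n - size M + 1"
    note b = partition_msets_bounds[OF M]
    have sub: "set_mset M \<subseteq> {1..?N}" using b by fastforce
    \<comment> \<open>Here \<open>n \<ge> 1\<close> enters: the empty multiset would belong to
      \<open>k = 0\<close>, outside the outer sum.\<close>
    have "M \<noteq> {#}" using M assms by (auto simp: partition_msets_def)
    hence sz: "1 \<le> size M" "size M \<le> n" using b(1) by (auto simp: Suc_le_eq nonempty_has_size)
    have s: "(\<Sum>i\<in>#M. G i) = (\<Sum>l=1..?N. count M l * G l)" for G :: "nat \<Rightarrow> nat"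
    proof -
      have "real (\<Sum>i\<in>#M. G i) = real (\<Sum>l=1..?N. count M l * G l)"
        using sum_mset_image_scaleR_count[OF _ sub, of "\<lambda>i. real (G i)"]
        by (simp add: of_nat_sum_mset multiset.map_comp comp_def)
      thus ?thesis by (simp only: of_nat_eq_iff)
    qed
    let ?j = "restrict (count M) {1..?N}"
    have "(\<Sum>l=1..?N. ?j l) = (\<Sum>l=1..?N. count M l * 1)"
      by (rule sum.cong[OF refl]) simp
    also have "\<dots> = size M" unfolding s[symmetric] by simp
    finally have "(\<Sum>l=1..?N. ?j l) = size M" .
    moreover have "(\<Sum>l=1..?N. l * ?j l) = (\<Sum>l=1..?N. count M l * l)"
      by (rule sum.cong[OF refl]) simp
    hence "(\<Sum>l=1..?N. l * ?j l) = n"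
      unfolding s[symmetric] using M by (simp add: partition_msets_def)
    moreover have "?j \<in> {1..?N} \<rightarrow>\<^sub>E UNIV" by (simp only: restrict_PiE_iff UNIV_I ball_triv simp_thms)
    ultimately have j: "?j \<in> bell_indices n (size M)"
      by (simp only: bell_indices_def mem_Collect_eq simp_thms)
    show "(size M, restrict (count M) {1..?N}) \<in> (SIGMA k:{1..n}. bell_indices n k)"
      using j sz by simp
    \<comment> \<open>No part lies outside the index range, so restricting the multiplicities loses
      nothing.\<close>
    have "count M l = 0" if "l \<notin> {1..?N}" for l
      using that sub by (meson count_eq_zero_iff subsetD)
    thus "(case (size M, restrict (count M) {1..?N}) of (k, j) \<Rightarrow> mset (bell_list n k j)) = M"
      by (auto simp: multiset_eq_iff count_bell_list)
  qed auto
  finally show ?thesis .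
qed

text \<open>The weighted sum of the \<open>j l\<close> is \<open>n\<close>, so the
  \<open>n\<close>-th Kronecker power of the increment splits into blocks of the same shape as the
  Bell summand. The mixed-product rule then contracts each factor separately.\<close>

lemma bell_summand_mult_kron_pow:
  fixes g :: "real ^ 'n::{finite,linorder} \<Rightarrow> real ^ 'm::{finite,linorder}"
  assumes "open S" "x \<in> S" "times_differentiable_on n g S" "1 \<le> k" "k \<le> n"
    and j: "j \<in> bell_indices n k"
  shows "kron_list (map (\<lambda>l. kron_pow ((1 / fact l) \<cdot>\<^sub>m deriv_mat l g x) (j l)) [1..<n-k+2]) *
      kron_pow (col_mat dx) n =
    (\<Prod>l=1..n-k+1. (1 / fact l) ^ j l) \<cdot>\<^sub>m
      kron_list (map col_mat (map (\<lambda>l. (dir_deriv dx ^^ l) g x) (bell_list n k j)))"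
proof -
  let ?ls = "[1..<n-k+2]" and ?X = "col_mat dx"
  let ?D = "\<lambda>l. (1 / fact l) \<cdot>\<^sub>m deriv_mat l g x"
  let ?w = "\<lambda>l. col_mat ((dir_deriv dx ^^ l) g x)"
  have D: "?D l \<in> carrier_mat CARD('m) (CARD('n) ^ l)" for l
    by (intro smult_carrier_mat deriv_mat_carrier)
  have X: "kron_pow ?X l \<in> carrier_mat (CARD('n) ^ l) (1 ^ l)" for l
    by (intro kron_pow_carrier col_mat_carrier)
  have w: "?D l * kron_pow ?X l = (1 / fact l) \<cdot>\<^sub>m ?w l" if "l \<in> set ?ls" for l
  proof -
    have "l \<le> n" using that assms(4,5) by auto
    hence "deriv_mat l g x * kron_pow ?X l = ?w l"
      by (intro deriv_mat_mult_kron_pow[OF assms(1,2)] times_differentiable_on_mono[OF assms(3)])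
    thus ?thesis by (simp add: mult_smult_assoc_mat[OF deriv_mat_carrier X])
  qed
  have "kron_pow ?X n = kron_pow ?X (sum_list (map (\<lambda>l. j l * l) ?ls))"
    using j by (simp only: sum_list_map_upt bell_indices_def mem_Collect_eq mult.commute[of "j _"])
  also have "\<dots> = kron_list (map (\<lambda>l. kron_pow (kron_pow ?X l) (j l)) ?ls)"
    by (simp only: kron_pow_sum_list kron_pow_mult_exp)
  finally have "kron_list (map (\<lambda>l. kron_pow (?D l) (j l)) ?ls) * kron_pow ?X n =
      kron_list (map (\<lambda>l. kron_pow (?D l) (j l) * kron_pow (kron_pow ?X l) (j l)) ?ls)"
    by (simp only:) (rule kron_list_mult[OF kron_pow_carrier[OF D] kron_pow_carrier[OF X]])
  also have "\<dots> = kron_list (map (\<lambda>l. (1 / fact l) ^ j l \<cdot>\<^sub>m kron_pow (?w l) (j l)) ?ls)"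
    by (intro arg_cong[where f = kron_list] map_cong refl)
      (subst kron_pow_mult[OF D X], simp only: w kron_pow_smult)
  also have "\<dots> = (\<Prod>l=1..n-k+1. (1 / fact l) ^ j l) \<cdot>\<^sub>m kron_list (map ?w (bell_list n k j))"
    by (simp only: kron_list_smult kron_list_kron_pow bell_list_def prod_list_map_upt)
  finally show ?thesis by (simp add: comp_def)
qed

lemma deriv_mat_bell_mat_kron_pow:
  fixes g :: "real ^ 'n::{finite,linorder} \<Rightarrow> real ^ 'm::{finite,linorder}"
    and f :: "real ^ 'm::{finite,linorder} \<Rightarrow> real ^ 'p::{finite,linorder}"
  assumes "open S" "x \<in> S" "open T" "g x \<in> T"
    and "times_differentiable_on n g S" "times_differentiable_on n f T"
    and k: "1 \<le> k" "k \<le> n" and i: "i < CARD('p)"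
  shows "(deriv_mat k f (g x) * bell_mat n k g x * kron_pow (col_mat dx) n) $$ (i, 0) =
    (\<Sum>j\<in>bell_indices n k. fact n / bell_weight (mset (bell_list n k j)) *
      vec_nth (bell_term g f dx (mset (bell_list n k j)) x) (nth_index i))"
proof -
  let ?A = "deriv_mat k f (g x)" and ?X = "kron_pow (col_mat dx) n"
  let ?c = "\<lambda>j. fact n / (\<Prod>l=1..n-k+1. fact (j l)) :: real"
  let ?B = "\<lambda>j. kron_list (map (\<lambda>l. kron_pow ((1 / fact l) \<cdot>\<^sub>m deriv_mat l g x) (j l)) [1..<n-k+2])"
  let ?w = "\<lambda>j. map (\<lambda>l. (dir_deriv dx ^^ l) g x) (bell_list n k j)"
  let ?p = "\<lambda>j. (\<Prod>l=1..n-k+1. (1 / fact l) ^ j l) :: real"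
  have A: "?A \<in> carrier_mat CARD('p) (CARD('m) ^ k)" by (rule deriv_mat_carrier)
  have X: "?X \<in> carrier_mat (CARD('n) ^ n) 1"
    using kron_pow_carrier[OF col_mat_carrier[of dx], of n] by simp
  have B: "?c j \<cdot>\<^sub>m ?B j \<in> carrier_mat (CARD('m) ^ k) (CARD('n) ^ n)"
    if "j \<in> bell_indices n k" for j
    by (intro smult_carrier_mat bell_summand_carrier that)
  have bell: "bell_mat n k g x \<in> carrier_mat (CARD('m) ^ k) (CARD('n) ^ n)"
    by (simp add: bell_mat_def mat_sum_def)
  have f: "times_differentiable_on k f T" by (rule times_differentiable_on_mono[OF assms(6) k(2)])
  have summand: "?A * ((?c j \<cdot>\<^sub>m ?B j) * ?X) =
      (?c j * ?p j) \<cdot>\<^sub>m col_mat (bell_term g f dx (mset (bell_list n k j)) x)"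
    if j: "j \<in> bell_indices n k" for j
  proof -
    have len: "length (?w j) = k" by (simp add: length_bell_list[OF j])
    have W: "kron_list (map col_mat (?w j)) \<in> carrier_mat (CARD('m) ^ k) 1"
      using kron_list_carrier[OF col_mat_carrier, of "\<lambda>v. v" "?w j"] len
      by (simp add: map_replicate_const)
    have BX: "(?c j \<cdot>\<^sub>m ?B j) * ?X = (?c j * ?p j) \<cdot>\<^sub>m kron_list (map col_mat (?w j))"
      unfolding mult_smult_assoc_mat[OF bell_summand_carrier[OF j] X]
        bell_summand_mult_kron_pow[OF assms(1,2,5) k j]
      by (rule eq_matI) auto
    have "?A * kron_list (map col_mat (?w j)) = col_mat (fold dir_deriv (?w j) f (g x))"
      using deriv_mat_mult_kron_list[OF assms(3,4), of "?w j" f] f by (simp only: len)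
    also have "fold dir_deriv (?w j) f (g x) = bell_term g f dx (mset (bell_list n k j)) x"
      by (rule bell_term_mset[where g = g and x = x, OF assms(3,4), symmetric]) (simp add: length_bell_list[OF j] f)
    finally show ?thesis
      unfolding BX mult_smult_distrib[OF A W] by simp
  qed
  have "?A * bell_mat n k g x * ?X = ?A * (bell_mat n k g x * ?X)"
    by (rule assoc_mult_mat[OF A bell X])
  also have "bell_mat n k g x * ?X =
      mat_sum (CARD('m) ^ k) 1 (\<lambda>j. (?c j \<cdot>\<^sub>m ?B j) * ?X) (bell_indices n k)"
    unfolding bell_mat_def by (rule mat_sum_mult[OF B X])
  also have "?A * \<dots> = mat_sum CARD('p) 1 (\<lambda>j. ?A * ((?c j \<cdot>\<^sub>m ?B j) * ?X)) (bell_indices n k)"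
    by (rule mult_mat_sum[OF A]) (rule mult_carrier_mat[OF B X])
  finally have "(?A * bell_mat n k g x * ?X) $$ (i, 0) =
      (\<Sum>j\<in>bell_indices n k. (?A * ((?c j \<cdot>\<^sub>m ?B j) * ?X)) $$ (i, 0))"
    using i by (simp add: mat_sum_def)
  also have "\<dots> = (\<Sum>j\<in>bell_indices n k. fact n / bell_weight (mset (bell_list n k j)) *
      vec_nth (bell_term g f dx (mset (bell_list n k j)) x) (nth_index i))"
  proof (rule sum.cong[OF refl])
    fix j assume j: "j \<in> bell_indices n k"
    \<comment> \<open>The multinomial-type coefficient and the scalings \<open>1 / fact l\<close>
      inside the Bell summand combine to the coefficient of the partition.\<close>
    have "?c j * ?p j = fact n / bell_weight (mset (bell_list n k j))"
      by (simp add: bell_weight_bell_list prod.distrib power_one_over prod_dividef)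
    thus "(?A * ((?c j \<cdot>\<^sub>m ?B j) * ?X)) $$ (i, 0) = fact n / bell_weight (mset (bell_list n k j)) *
        vec_nth (bell_term g f dx (mset (bell_list n k j)) x) (nth_index i)"
      unfolding summand[OF j] using i by (simp add: col_mat_def)
  qed
  finally show ?thesis .
qed

section \<open>Faa di Bruno's formula in Kronecker form\<close>

theorem theorem4:
  fixes f :: "real ^ 'm::{finite,linorder} \<Rightarrow> real ^ 'p::{finite,linorder}"
    and g :: "real ^ 'n::{finite,linorder} \<Rightarrow> real ^ 'm::{finite,linorder}"
    and Df :: "(real ^ 'm::{finite,linorder}) set" and Dg :: "(real ^ 'n::{finite,linorder}) set"
    and n :: nat
  assumes "n \<ge> 1"
    and "open Dg" and "open Df"
    and "times_differentiable_on n g Dg"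
    and "g ` Dg \<subseteq> Df"
    and "times_differentiable_on n f Df"
  shows "times_differentiable_on n (f \<circ> g) Dg \<and>
    (\<forall>x\<in>Dg. \<forall>dx.
      differential n (f \<circ> g) x dx =
        mat_sum CARD('p) 1
          (\<lambda>k. deriv_mat k f (g x) * bell_mat n k g x * kron_pow (col_mat dx) n) {1..n})"
proof (intro conjI ballI allI)
  show td: "times_differentiable_on n (f \<circ> g) Dg"
    using times_differentiable_on_compose[OF assms(2,3,5,4,6)] by (simp add: comp_def)
  fix x dx :: "real ^ 'n::{finite,linorder}" assume x: "x \<in> Dg"
  hence gx: "g x \<in> Df" using assms(5) by auto
  let ?P = "\<lambda>k. deriv_mat k f (g x) * bell_mat n k g x * kron_pow (col_mat dx) n"
  have L: "differential n (f \<circ> g) x dx = col_mat ((dir_deriv dx ^^ n) (f \<circ> g) x)"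
    unfolding differential_def by (rule deriv_mat_mult_kron_pow[OF assms(2) x td])
  show "differential n (f \<circ> g) x dx = mat_sum CARD('p) 1 ?P {1..n}"
  proof (rule eq_matI)
    fix i j assume "i < dim_row (mat_sum CARD('p) 1 ?P {1..n})"
      "j < dim_col (mat_sum CARD('p) 1 ?P {1..n})"
    hence i: "i < CARD('p)" and [simp]: "j = 0" by (auto simp: mat_sum_def)
    have "mat_sum CARD('p) 1 ?P {1..n} $$ (i, j) = (\<Sum>k=1..n. ?P k $$ (i, 0))"
      using i by (simp add: mat_sum_def)
    \<comment> \<open>Summing over \<open>k\<close> collects the partitions of every size from 1 to
      \<open>n\<close>.\<close>
    also have "\<dots> = (\<Sum>M\<in>partition_msets n. fact n / bell_weight M *
        vec_nth (bell_term g f dx M x) (nth_index i))"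
      by (simp add: deriv_mat_bell_mat_kron_pow[OF assms(2) x assms(3) gx assms(4,6) _ _ i]
          flip: sum_bell_indices[OF assms(1)])
    also have "\<dots> = vec_nth ((dir_deriv dx ^^ n) (f \<circ> g) x) (nth_index i)"
      by (simp add: funpow_dir_deriv_compose[OF assms(2,3,5,4,6) x])
    finally show "differential n (f \<circ> g) x dx $$ (i, j) = mat_sum CARD('p) 1 ?P {1..n} $$ (i, j)"
      using i by (simp add: L col_mat_def)
  qed (simp_all add: L col_mat_def mat_sum_def)
qed

end
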